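(* Let $A$ be a non-unital C*-algebra. Then $A$ is a weakly Rickart C*-algebra if and only if every maximal abelian self-adjoint subalgebra of $A$ is monotone $\sigma$-complete.
   Context: For $x$ in a C*-algebra $A$, a projection $e\in A$ is an annihilating right projection (ARP) for $x$ if $xe=x$ and, whenever $y\in A$ satisfies $xy=0$, then $ey=0$. A C*-algebra $A$ is weakly Rickart if every $x\in A$ has an annihilating right projection in $A$. A C*-algebra $B$ is monotone $\sigma$-complete if every norm-bounded monotone increasing sequence in $B_{sa}$ has a supremum in $B_{sa}$ (for a maximal abelian self-adjoint subalgebra $M$, suprema are taken in $M_{sa}$). *)

theory Defs
  imports Complex_Main
begin

text \<open>Abstract (possibly non-unital) C*-algebras: a complex Banach algebra with an
  isometric-type involution satisfying the C*-identity. The underlying ring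
  structure comes from real_normed_algebra (which does not require a unit);
  complex scalar multiplication is the operation cscale, compatible with scaleR.\<close>

class cstar_algebra = real_normed_algebra + banach +
  fixes cscale :: "complex \<Rightarrow> 'a \<Rightarrow> 'a"
    and invol :: "'a \<Rightarrow> 'a"
  assumes cscale_add_right: "cscale c (x + y) = cscale c x + cscale c y"
    and cscale_add_left: "cscale (c + d) x = cscale c x + cscale d x"
    and cscale_cscale: "cscale c (cscale d x) = cscale (c * d) x"
    and cscale_one: "cscale 1 x = x"
    and cscale_of_real: "cscale (complex_of_real r) x = scaleR r x"
    and cscale_mult_left: "cscale c (x * y) = cscale c x * y"
    and cscale_mult_right: "cscale c (x * y) = x * cscale c y"
    and norm_cscale: "norm (cscale c x) = cmod c * norm x"
    and invol_invol: "invol (invol x) = x"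
    and invol_add: "invol (x + y) = invol x + invol y"
    and invol_mult: "invol (x * y) = invol y * invol x"
    and invol_cscale: "invol (cscale c x) = cscale (cnj c) (invol x)"
    and cstar_identity: "norm (invol x * x) = norm x * norm x"

definition unital :: "'a::cstar_algebra itself \<Rightarrow> bool" where
  "unital _ \<longleftrightarrow> (\<exists>e::'a. \<forall>x. e * x = x \<and> x * e = x)"

context cstar_algebra
begin

definition is_projection :: "'a \<Rightarrow> bool" where
  "is_projection e \<longleftrightarrow> invol e = e \<and> e * e = e"

definition is_ARP :: "'a \<Rightarrow> 'a \<Rightarrow> bool" where
  "is_ARP x e \<longleftrightarrow> is_projection e \<and> x * e = x \<and> (\<forall>y. x * y = 0 \<longrightarrow> e * y = 0)"


definition star_subalgebra :: "'a set \<Rightarrow> bool" where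
  "star_subalgebra S \<longleftrightarrow> 0 \<in> S \<and>
     (\<forall>x\<in>S. \<forall>y\<in>S. x + y \<in> S \<and> x * y \<in> S) \<and>
     (\<forall>c. \<forall>x\<in>S. cscale c x \<in> S) \<and>
     (\<forall>x\<in>S. invol x \<in> S)"

definition abelian :: "'a set \<Rightarrow> bool" where
  "abelian S \<longleftrightarrow> (\<forall>x\<in>S. \<forall>y\<in>S. x * y = y * x)"

definition masa :: "'a set \<Rightarrow> bool" where
  "masa M \<longleftrightarrow> star_subalgebra M \<and> abelian M \<and>
     (\<forall>N. star_subalgebra N \<and> abelian N \<and> M \<subseteq> N \<longrightarrow> N = M)"

definition self_adjoint_part :: "'a set \<Rightarrow> 'a set" where
  "self_adjoint_part S = {x \<in> S. invol x = x}"

definition positive :: "'a \<Rightarrow> bool" where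
  "positive a \<longleftrightarrow> (\<exists>c. a = invol c * c)"

definition sa_le :: "'a \<Rightarrow> 'a \<Rightarrow> bool" where
  "sa_le a b \<longleftrightarrow> positive (b - a)"

definition monotone_sigma_complete :: "'a set \<Rightarrow> bool" where
  "monotone_sigma_complete M \<longleftrightarrow>
     (\<forall>f :: nat \<Rightarrow> 'a.
        (\<forall>n. f n \<in> self_adjoint_part M) \<and> (\<forall>n. sa_le (f n) (f (Suc n))) \<and>
        (\<exists>B. \<forall>n. norm (f n) \<le> B)
        \<longrightarrow> (\<exists>s\<in>self_adjoint_part M. (\<forall>n. sa_le (f n) s) \<and>
               (\<forall>t\<in>self_adjoint_part M. (\<forall>n. sa_le (f n) t) \<longrightarrow> sa_le s t)))"

end

definition weakly_rickart :: "'a::cstar_algebra itself \<Rightarrow> bool" where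
  "weakly_rickart _ \<longleftrightarrow> (\<forall>x::'a. \<exists>e. is_ARP x e)"

end

theory Submission
  imports Defs
begin

text \<open>A masa \<open>M\<close> is its own commutant, so roots and positive parts of its elements stay in \<open>M\<close>.

  If \<open>A\<close> is weakly Rickart, annihilating right projections of elements of \<open>M\<close> lie in \<open>M\<close>, and
  \<open>\<Sum>n. 2\<^sup>-\<^sup>n h\<^sub>n\<close> provides a supremum of countably many supports. A bounded increasing sequence
  \<open>0 \<le> g\<^sub>n \<le> c e\<close> then has the supremum \<open>\<Sum>k. (c / 2\<^sup>k\<^sup>+\<^sup>1) p\<^sub>k\<close>, where the projections \<open>p\<^sub>k\<close> are the
  binary digits of the pointwise supremum, found greedily.

  Conversely, for \<open>0 \<le> a \<le> 1\<close> in \<open>M\<close> the supremum in \<open>M\<close> of \<open>a\<^bsup>1/2^n\<^esup>\<close> is the support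
  projection of \<open>a\<close> relative to \<open>M\<close>. It depends on \<open>M\<close>, but a suitable choice of \<open>M\<close> makes it the
  least projection \<open>e\<close> of \<open>A\<close> with \<open>a e = a\<close>. If \<open>a y = 0\<close>, the support of \<open>a\<close> relative to a masa
  containing \<open>a\<close> and \<open>y y\<^sup>*\<close> is orthogonal to \<open>y y\<^sup>*\<close> and dominates \<open>e\<close>, so \<open>e y = 0\<close>.

  Positivity is handled without a unitization and without the Gelfand representation, through
  the norm of the multipliers \<open>y \<mapsto> t y + c y\<close> on \<open>A\<close>.\<close>

subsection \<open>Square roots and positivity\<close>

lemma invol_0 [simp]: "invol (0::'a::cstar_algebra) = 0"
  using invol_add[of "0::'a" 0] by simp

lemma invol_minus [simp]: "invol (- x) = - invol (x::'a::cstar_algebra)"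
  using invol_add[of x "-x"] by (simp add: minus_unique)

lemma invol_diff [simp]: "invol (x - y) = invol x - invol (y::'a::cstar_algebra)"
  using invol_add[of x "-y"] by simp

lemma invol_scaleR [simp]: "invol (r *\<^sub>R x) = r *\<^sub>R invol (x::'a::cstar_algebra)"
  using invol_cscale[of "complex_of_real r" x] by (simp add: cscale_of_real)

declare invol_invol [simp] invol_add [simp] invol_mult [simp] invol_cscale [simp]

lemma cscale_0 [simp]: "cscale c (0::'a::cstar_algebra) = 0"
  using cscale_add_right[of c "0::'a" 0] by simp

lemma cscale_minus [simp]: "cscale c (- x) = - cscale c (x::'a::cstar_algebra)"
  using cscale_add_right[of c x "-x"] by (simp add: minus_unique)

lemma cscale_diff: "cscale c (x - y) = cscale c x - cscale c (y::'a::cstar_algebra)"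
  using cscale_add_right[of c x "-y"] by simp

lemma cscale_uminus_left [simp]: "cscale (- c) x = - cscale c (x::'a::cstar_algebra)"
proof -
  have "cscale 0 x = 0" using cscale_of_real[of 0 x] by simp
  then show ?thesis using cscale_add_left[of c "-c" x] by (simp add: minus_unique)
qed

lemma cscale_i_i [simp]: "cscale \<i> (cscale \<i> x) = - (x::'a::cstar_algebra)"
  by (simp add: cscale_cscale cscale_one)

lemma mult_cscale_left [simp]: "cscale c x * y = cscale c (x * (y::'a::cstar_algebra))"
  by (simp add: cscale_mult_left)

lemma mult_cscale_right [simp]: "x * cscale c y = cscale c (x * (y::'a::cstar_algebra))"
  by (simp add: cscale_mult_right)

lemma norm_invol [simp]: "norm (invol x) = norm (x::'a::cstar_algebra)"
proof -
  have le: "norm y \<le> norm (invol y)" for y :: 'a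
  proof (cases "norm y = 0")
    case False
    have "norm y * norm y \<le> norm (invol y) * norm y"
      using cstar_identity[of y] norm_mult_ineq[of "invol y" y] by simp
    with False show ?thesis by (simp add: mult_le_cancel_right)
  qed auto
  show ?thesis using le[of x] le[of "invol x"] by simp
qed

lemma cstar_identity': "norm (x * invol x) = norm x * norm (x::'a::cstar_algebra)"
  using cstar_identity[of "invol x"] by simp

lemma invol_mult_self_eq_0: "invol x * x = 0 \<longleftrightarrow> (x::'a::cstar_algebra) = 0"
  by (metis cstar_identity mult_eq_0_iff norm_eq_zero mult_zero_right)

lemma mult_invol_self_eq_0: "x * invol x = 0 \<longleftrightarrow> (x::'a::cstar_algebra) = 0"
  by (metis cstar_identity' mult_eq_0_iff norm_eq_zero mult_zero_left)

lemma norm_square_sa: "invol b = b \<Longrightarrow> norm (b * b) = norm b * norm (b::'a::cstar_algebra)"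
  using cstar_identity[of b] by simp

lemma square_sa_eq_0: "invol b = b \<Longrightarrow> b * b = 0 \<longleftrightarrow> (b::'a::cstar_algebra) = 0"
  using invol_mult_self_eq_0[of b] by simp

lemma cube_sa_eq_0: "invol b = b \<Longrightarrow> b * (b * b) = 0 \<longleftrightarrow> (b::'a::cstar_algebra) = 0"
proof
  assume b: "invol b = b" and "b * (b * b) = 0"
  then have "(b * b) * (b * b) = 0" by (simp add: mult.assoc)
  then show "b = 0" using square_sa_eq_0[of "b*b"] square_sa_eq_0[of b] b by simp
qed simp

lemma bounded_linear_invol: "bounded_linear (invol :: 'a::cstar_algebra \<Rightarrow> 'a)"
  by (rule bounded_linear_intro[where K=1]) auto

lemmas tendsto_invol = bounded_linear.tendsto[OF bounded_linear_invol]

section \<open>Multipliers and their norm bounds\<close>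

text \<open>\<open>mbound t c r\<close> says that the element \<open>t + c\<close> of the unitization, acting on \<open>A\<close> by left
  multiplication, has operator norm at most \<open>r\<close>.\<close>

definition mbound :: "real \<Rightarrow> 'a::cstar_algebra \<Rightarrow> real \<Rightarrow> bool" where
  "mbound t c r \<longleftrightarrow> (\<forall>y. norm (t *\<^sub>R y + c * y) \<le> r * norm y)"

lemma mbound_add: "mbound t c r \<Longrightarrow> mbound t' c' r' \<Longrightarrow> mbound (t + t') (c + c') (r + r')"
  unfolding mbound_def
proof
  fix y assume "\<forall>y. norm (t *\<^sub>R y + c * y) \<le> r * norm y" "\<forall>y. norm (t' *\<^sub>R y + c' * y) \<le> r' * norm y"
  then have "norm (t *\<^sub>R y + c * y) \<le> r * norm y" "norm (t' *\<^sub>R y + c' * y) \<le> r' * norm y" by auto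
  moreover have "(t + t') *\<^sub>R y + (c + c') * y = (t *\<^sub>R y + c * y) + (t' *\<^sub>R y + c' * y)"
    by (simp add: algebra_simps)
  ultimately show "norm ((t + t') *\<^sub>R y + (c + c') * y) \<le> (r + r') * norm y"
    using norm_triangle_ineq[of "t *\<^sub>R y + c * y" "t' *\<^sub>R y + c' * y"] by (simp add: algebra_simps)
qed

lemma mbound_scale:
  assumes "mbound t c r" "0 \<le> k" shows "mbound (k * t) (k *\<^sub>R c) (k * r)"
  unfolding mbound_def
proof
  fix y
  have "(k * t) *\<^sub>R y + (k *\<^sub>R c) * y = k *\<^sub>R (t *\<^sub>R y + c * y)" by (simp add: algebra_simps)
  moreover have "norm (t *\<^sub>R y + c * y) \<le> r * norm y" using assms by (simp add: mbound_def)
  ultimately show "norm ((k * t) *\<^sub>R y + (k *\<^sub>R c) * y) \<le> k * r * norm y"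
    using assms(2) by (simp add: mult.assoc mult_left_mono)
qed

lemma mbound_mult:
  assumes "mbound t c r" "mbound t' c' r'" "0 \<le> r"
  shows "mbound (t * t') (t *\<^sub>R c' + t' *\<^sub>R c + c * c') (r * r')"
  unfolding mbound_def
proof
  fix y
  let ?z = "t' *\<^sub>R y + c' * y"
  have "norm (t *\<^sub>R ?z + c * ?z) \<le> r * norm ?z" using assms(1) by (simp add: mbound_def)
  also have "\<dots> \<le> r * (r' * norm y)" using assms(2,3) by (simp add: mbound_def mult_left_mono)
  finally show "norm ((t * t') *\<^sub>R y + (t *\<^sub>R c' + t' *\<^sub>R c + c * c') * y) \<le> r * r' * norm y"
    by (simp add: algebra_simps)
qed

lemma mbound_scalar: "0 \<le> k \<Longrightarrow> mbound k 0 k"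
  by (simp add: mbound_def)

lemma mbound_element: "norm c \<le> r \<Longrightarrow> mbound 0 c r"
  unfolding mbound_def by (auto intro!: order_trans[OF norm_mult_ineq] mult_right_mono)

text \<open>In place of a unit, the multiplier is tested on \<open>invol c\<close>, where the
  C*-identity recovers \<open>norm c\<close> from \<open>c * invol c\<close>.\<close>

lemma mbound_norm_le:
  assumes "mbound t c r" "0 \<le> r" shows "norm c \<le> r + \<bar>t\<bar>"
proof (cases "c = 0")
  case False
  let ?y = "invol c"
  have "norm c * norm c = norm ((t *\<^sub>R ?y + c * ?y) - t *\<^sub>R ?y)"
    by (simp add: cstar_identity')
  also have "\<dots> \<le> norm (t *\<^sub>R ?y + c * ?y) + norm (t *\<^sub>R ?y)" by (rule norm_triangle_ineq4)
  also have "\<dots> \<le> r * norm ?y + \<bar>t\<bar> * norm ?y"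
    using assms unfolding mbound_def by (intro add_mono) (blast, simp)
  finally have "norm c * norm c \<le> (r + \<bar>t\<bar>) * norm c" by (simp add: algebra_simps)
  with False show ?thesis by (simp add: mult_le_cancel_right)
qed (use assms in auto)

lemma mbound_tendsto:
  assumes "\<And>k. mbound (t k) (c k) (r k)" "t \<longlonglongrightarrow> t'" "c \<longlonglongrightarrow> c'" "r \<longlonglongrightarrow> r'"
  shows "mbound t' c' r'"
  unfolding mbound_def
proof
  fix y
  show "norm (t' *\<^sub>R y + c' * y) \<le> r' * norm y"
  proof (rule LIMSEQ_le)
    show "(\<lambda>k. norm (t k *\<^sub>R y + c k * y)) \<longlonglongrightarrow> norm (t' *\<^sub>R y + c' * y)"
      by (intro tendsto_intros assms)
    show "(\<lambda>k. r k * norm y) \<longlonglongrightarrow> r' * norm y" by (intro tendsto_intros assms)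
  qed (use assms(1) in \<open>auto simp: mbound_def\<close>)
qed

section \<open>Square roots by iteration\<close>

text \<open>\<open>tseq \<tau> k + cseq \<tau> x k\<close> is the \<open>k\<close>-th iterate of \<open>s \<mapsto> (\<tau> + x + s\<^sup>2) / 2\<close> from \<open>s = 0\<close>, whose limit is
  \<open>1 - sqrt (1 - \<tau> - x)\<close>. The iterates are polynomials in \<open>\<tau> + x\<close> with increasing nonnegative
  coefficients, so for \<open>\<tau> + x\<close> of norm at most \<open>1\<close> the scalar sequence \<open>tseq 1\<close> dominates them.\<close>

primrec tseq :: "real \<Rightarrow> nat \<Rightarrow> real" where
  "tseq \<tau> 0 = 0"
| "tseq \<tau> (Suc k) = (\<tau> + tseq \<tau> k * tseq \<tau> k) / 2"

primrec cseq :: "real \<Rightarrow> 'a::cstar_algebra \<Rightarrow> nat \<Rightarrow> 'a" where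
  "cseq \<tau> x 0 = 0"
| "cseq \<tau> x (Suc k) = (1/2) *\<^sub>R x + tseq \<tau> k *\<^sub>R cseq \<tau> x k + (1/2) *\<^sub>R (cseq \<tau> x k * cseq \<tau> x k)"

lemma tseq_bounds: "0 \<le> tseq 1 k \<and> tseq 1 k \<le> 1 \<and> tseq 1 k \<le> tseq 1 (Suc k)"
proof (induction k)
  case (Suc k)
  have "tseq 1 k * tseq 1 k \<le> tseq 1 (Suc k) * tseq 1 (Suc k)" using Suc by (intro mult_mono) auto
  moreover have "tseq 1 k * tseq 1 k \<le> 1" using Suc by (intro mult_le_one) auto
  ultimately show ?case by simp
qed simp

lemma tseq_convergent: "tseq 1 \<longlonglongrightarrow> 1"
proof -
  have "Bseq (tseq 1)" using tseq_bounds by (intro BseqI'[where K=1]) auto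
  moreover have "incseq (tseq 1)" using tseq_bounds by (intro incseq_SucI) auto
  ultimately obtain L where L: "tseq 1 \<longlonglongrightarrow> L"
    by (meson Bseq_mono_convergent convergent_def incseqD)
  have "(\<lambda>k. tseq 1 (Suc k)) \<longlonglongrightarrow> (1 + L * L) / 2" by (simp, intro tendsto_intros L) auto
  then have "L = (1 + L * L) / 2" using L LIMSEQ_Suc LIMSEQ_unique by blast
  then have "(L - 1) * (L - 1) = 0" by (simp add: algebra_simps)
  with L show ?thesis by simp
qed

lemma tseq_0 [simp]: "tseq 0 k = 0"
  by (induction k) auto

lemma cseq_intertwine:
  assumes "d * x = x' * d" shows "d * cseq \<tau> x k = cseq \<tau> x' k * d"
proof (induction k)
  case (Suc k)
  have "d * (cseq \<tau> x k * cseq \<tau> x k) = cseq \<tau> x' k * cseq \<tau> x' k * d"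
    by (metis Suc mult.assoc)
  then show ?case by (simp add: distrib_left distrib_right assms Suc)
qed simp

lemma cseq_comm: "cseq \<tau> x j * cseq \<tau> x k = cseq \<tau> x k * cseq \<tau> x j"
  by (rule cseq_intertwine, rule cseq_intertwine[symmetric]) simp

lemma cseq_sa: "invol x = x \<Longrightarrow> invol (cseq \<tau> x k) = cseq \<tau> x k"
  by (induction k) auto

text \<open>Consecutive iterates \<open>s\<close>, \<open>s'\<close>, \<open>s''\<close> satisfy
  \<open>s'' - s' = (s' - s) * (s' + s) / 2\<close>, and the scalars \<open>tseq 1\<close> obey the
  same recursion, so the bounds for the two factors multiply to the bound for the next
  increment.\<close>

lemma cseq_bounds:
  assumes "mbound \<tau> x 1"
  shows "mbound (tseq \<tau> k) (cseq \<tau> x k) (tseq 1 k)"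
    and "mbound (tseq \<tau> (Suc k) - tseq \<tau> k) (cseq \<tau> x (Suc k) - cseq \<tau> x k) (tseq 1 (Suc k) - tseq 1 k)"
proof -
  have "mbound (tseq \<tau> k) (cseq \<tau> x k) (tseq 1 k) \<and>
    mbound (tseq \<tau> (Suc k) - tseq \<tau> k) (cseq \<tau> x (Suc k) - cseq \<tau> x k) (tseq 1 (Suc k) - tseq 1 k)"
  proof (induction k)
    case 0
    show ?case using mbound_scale[OF assms, of "1/2"] mbound_scalar[of 0] by simp
  next
    case (Suc k)
    let ?t = "tseq \<tau> k" and ?t' = "tseq \<tau> (Suc k)" and ?r = "tseq 1 k" and ?r' = "tseq 1 (Suc k)"
    let ?c = "cseq \<tau> x k" and ?c' = "cseq \<tau> x (Suc k)"
    from Suc have A: "mbound ?t ?c ?r" and D: "mbound (?t' - ?t) (?c' - ?c) (?r' - ?r)" by auto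
    from mbound_add[OF D A] have A': "mbound ?t' ?c' ?r'" by simp
    have S: "mbound (?t' + ?t) (?c' + ?c) (?r' + ?r)" by (rule mbound_add[OF A' A])
    have "?r \<le> ?r'" using tseq_bounds by blast
    then have P: "mbound ((?t' - ?t) * (?t' + ?t))
      ((?t' - ?t) *\<^sub>R (?c' + ?c) + (?t' + ?t) *\<^sub>R (?c' - ?c) + (?c' - ?c) * (?c' + ?c))
      ((?r' - ?r) * (?r' + ?r))" by (intro mbound_mult[OF D S]) auto
    have t: "(1/2) * ((tseq \<sigma> (Suc k) - tseq \<sigma> k) * (tseq \<sigma> (Suc k) + tseq \<sigma> k))
        = tseq \<sigma> (Suc (Suc k)) - tseq \<sigma> (Suc k)" for \<sigma>
      by (simp only: tseq.simps(2)[of \<sigma> "Suc k"], simp only: tseq.simps(2)[of \<sigma> k])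
        (simp add: algebra_simps)
    have comm: "?c * ?c' = ?c' * ?c" by (rule cseq_comm)
    have "(?t' - ?t) *\<^sub>R (?c' + ?c) + (?t' + ?t) *\<^sub>R (?c' - ?c) + (?c' - ?c) * (?c' + ?c)
        = 2 *\<^sub>R (?t' *\<^sub>R ?c' - ?t *\<^sub>R ?c) + (?c' * ?c' - ?c * ?c)"
      by (simp only: comm scaleR_2 algebra_simps scaleR_left_diff_distrib scaleR_left_distrib
        scaleR_right_diff_distrib scaleR_right_distrib)
    then have c: "(1/2) *\<^sub>R ((?t' - ?t) *\<^sub>R (?c' + ?c) + (?t' + ?t) *\<^sub>R (?c' - ?c) + (?c' - ?c) * (?c' + ?c))
        = cseq \<tau> x (Suc (Suc k)) - ?c'"
      by (simp only: cseq.simps(2)[of \<tau> x "Suc k"], simp only: cseq.simps(2)[of \<tau> x k])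
        (simp add: algebra_simps)
    have "mbound (tseq \<tau> (Suc (Suc k)) - ?t') (cseq \<tau> x (Suc (Suc k)) - ?c') (tseq 1 (Suc (Suc k)) - ?r')"
      using mbound_scale[OF P, of "1/2"] unfolding t c by simp
    with A' show ?case by blast
  qed
  then show "mbound (tseq \<tau> k) (cseq \<tau> x k) (tseq 1 k)"
    "mbound (tseq \<tau> (Suc k) - tseq \<tau> k) (cseq \<tau> x (Suc k) - cseq \<tau> x k) (tseq 1 (Suc k) - tseq 1 k)" by auto
qed

lemma cseq_convergent:
  assumes "\<tau> = 0 \<or> \<tau> = 1" "mbound \<tau> x 1" shows "convergent (cseq \<tau> x)"
proof -
  \<comment> \<open>\<open>mbound_norm_le\<close> adds the scalar increment, which for both values
    of \<open>\<tau>\<close> is at most that of \<open>tseq 1\<close>; hence the factor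
    \<open>2\<close>.\<close>
  have d: "norm (cseq \<tau> x (Suc k) - cseq \<tau> x k) \<le> 2 * (tseq 1 (Suc k) - tseq 1 k)" for k
  proof -
    have r: "tseq 1 k \<le> tseq 1 (Suc k)" using tseq_bounds by blast
    have "\<bar>tseq \<tau> (Suc k) - tseq \<tau> k\<bar> \<le> tseq 1 (Suc k) - tseq 1 k"
      using assms(1) r by (auto simp del: tseq.simps)
    moreover have "norm (cseq \<tau> x (Suc k) - cseq \<tau> x k)
        \<le> (tseq 1 (Suc k) - tseq 1 k) + \<bar>tseq \<tau> (Suc k) - tseq \<tau> k\<bar>"
      by (rule mbound_norm_le[OF cseq_bounds(2)[OF assms(2)]]) (use r in linarith)
    moreover have "y \<le> d \<Longrightarrow> z \<le> d + y \<Longrightarrow> z \<le> 2 * d" for y z d :: real by simp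
    ultimately show ?thesis by blast
  qed
  have "summable (\<lambda>k. 2 * (tseq 1 (Suc k) - tseq 1 k))"
    by (intro summable_mult telescope_summable[OF tseq_convergent])
  then have "summable (\<lambda>k. cseq \<tau> x (Suc k) - cseq \<tau> x k)"
    by (rule summable_comparison_test') (use d in blast)
  then obtain S where "(\<lambda>n. \<Sum>k<n. cseq \<tau> x (Suc k) - cseq \<tau> x k) \<longlonglongrightarrow> S"
    by (auto simp: summable_def sums_def)
  then have "cseq \<tau> x \<longlonglongrightarrow> S" by (simp only: sum_lessThan_telescope) simp
  then show ?thesis by (auto simp: convergent_def)
qed

text \<open>For \<open>\<tau> = 1\<close> this is the negative of the square root of
  \<open>- x\<close>; for \<open>\<tau> = 0\<close> it is \<open>1 - sqrt (1 - x)\<close>. In both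
  cases the scalar parts of the iterates converge to \<open>\<tau>\<close>.\<close>

definition msqrt :: "real \<Rightarrow> 'a::cstar_algebra \<Rightarrow> 'a" where
  "msqrt \<tau> x = lim (cseq \<tau> x)"

context
  fixes \<tau> :: real and x :: "'a::cstar_algebra"
  assumes \<tau>: "\<tau> = 0 \<or> \<tau> = 1" and x: "mbound \<tau> x 1"
begin

lemma cseq_tendsto: "cseq \<tau> x \<longlonglongrightarrow> msqrt \<tau> x"
  unfolding msqrt_def using cseq_convergent[OF \<tau> x] by (simp add: convergent_LIMSEQ_iff)

lemma tseq_tendsto: "tseq \<tau> \<longlonglongrightarrow> \<tau>"
  using \<tau> tseq_convergent by (auto intro: LIMSEQ_I)

lemma msqrt_eq: "2 *\<^sub>R msqrt \<tau> x = x + (2 * \<tau>) *\<^sub>R msqrt \<tau> x + msqrt \<tau> x * msqrt \<tau> x"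
proof -
  have "(\<lambda>k. cseq \<tau> x (Suc k)) \<longlonglongrightarrow>
      (1/2) *\<^sub>R x + \<tau> *\<^sub>R msqrt \<tau> x + (1/2) *\<^sub>R (msqrt \<tau> x * msqrt \<tau> x)"
    by (simp, intro tendsto_intros cseq_tendsto tseq_tendsto)
  then have "msqrt \<tau> x = (1/2) *\<^sub>R x + \<tau> *\<^sub>R msqrt \<tau> x + (1/2) *\<^sub>R (msqrt \<tau> x * msqrt \<tau> x)"
    using LIMSEQ_Suc[OF cseq_tendsto] LIMSEQ_unique by blast
  then have "2 *\<^sub>R msqrt \<tau> x = 2 *\<^sub>R ((1/2) *\<^sub>R x + \<tau> *\<^sub>R msqrt \<tau> x + (1/2) *\<^sub>R (msqrt \<tau> x * msqrt \<tau> x))"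
    by simp
  then show ?thesis by (simp add: scaleR_right_distrib)
qed

lemma msqrt_bound: "mbound \<tau> (msqrt \<tau> x) 1"
  by (rule mbound_tendsto[OF cseq_bounds(1)[OF x] tseq_tendsto cseq_tendsto tseq_convergent])

lemma msqrt_sa: "invol x = x \<Longrightarrow> invol (msqrt \<tau> x) = msqrt \<tau> x"
  using tendsto_invol[OF cseq_tendsto] cseq_sa[of x \<tau>] cseq_tendsto LIMSEQ_unique by simp blast

lemma msqrt_intertwine:
  assumes "mbound \<tau> x' 1" "d * x = x' * d"
  shows "d * msqrt \<tau> x = msqrt \<tau> x' * d"
proof -
  have "(\<lambda>k. d * cseq \<tau> x k) \<longlonglongrightarrow> d * msqrt \<tau> x" by (intro tendsto_intros cseq_tendsto)
  moreover have "cseq \<tau> x' \<longlonglongrightarrow> msqrt \<tau> x'"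
    unfolding msqrt_def using cseq_convergent[OF \<tau> assms(1)] by (simp add: convergent_LIMSEQ_iff)
  then have "(\<lambda>k. cseq \<tau> x' k * d) \<longlonglongrightarrow> msqrt \<tau> x' * d" by (intro tendsto_intros)
  ultimately show ?thesis using cseq_intertwine[OF assms(2)] LIMSEQ_unique by simp blast
qed

end

section \<open>The cone of positive elements\<close>

text \<open>Equivalent to \<open>positive\<close> (see \<open>positive_iff_spos\<close>), but visibly closed under sums.\<close>

definition spos :: "'a::cstar_algebra \<Rightarrow> bool" where
  "spos a \<longleftrightarrow> invol a = a \<and> (\<exists>r>0. mbound r (- a) r)"

lemma sposD [simp]: "spos a \<Longrightarrow> invol a = a" by (simp add: spos_def)

lemma spos_0 [simp]: "spos 0"
  unfolding spos_def by (auto simp: mbound_scalar intro!: exI[of _ 1])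

lemma mbound_mono:
  assumes "mbound r (- a) r" "r \<le> r'" shows "mbound r' (- a) r'"
  using mbound_add[OF assms(1) mbound_scalar[of "r' - r"]] assms(2) by simp

lemma spos_add: "spos a \<Longrightarrow> spos b \<Longrightarrow> spos (a + b)"
  unfolding spos_def
proof clarify
  fix r r' :: real
  assume "invol a = a" "invol b = b" "0 < r" "0 < r'" "mbound r (- a) r" "mbound r' (- b) r'"
  then show "invol (a + b) = a + b \<and> (\<exists>r>0. mbound r (- (a + b)) r)"
    using mbound_add[of r "-a" r r' "-b" r'] by (auto intro!: exI[of _ "r + r'"])
qed

lemma spos_scale:
  assumes "spos a" "0 \<le> k" shows "spos (k *\<^sub>R a)"
proof (cases "k = 0")
  case False
  with assms(2) have "k > 0" by simp
  from assms(1) obtain r where "invol a = a" "r > 0" "mbound r (- a) r" by (auto simp: spos_def)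
  with \<open>k > 0\<close> show ?thesis unfolding spos_def
    using mbound_scale[of r "-a" r k] by (auto intro!: exI[of _ "k * r"])
qed simp

text \<open>The radius \<open>r\<close> is an explicit argument so that roots of two different
  elements arise as limits of the same polynomials, which is what \<open>rsqrt_intertwine\<close>
  relies on.\<close>

definition rsqrt :: "real \<Rightarrow> 'a::cstar_algebra \<Rightarrow> 'a" where
  "rsqrt r a = sqrt r *\<^sub>R - msqrt 1 (- ((1 / r) *\<^sub>R a))"

context
  fixes r :: real and a :: "'a::cstar_algebra"
  assumes r: "r > 0" and a: "mbound r (- a) r"
begin

lemma mbound_normalized: "mbound 1 (- ((1 / r) *\<^sub>R a)) 1"
  using mbound_scale[OF a, of "1/r"] r by simp

lemma rsqrt_square: "rsqrt r a * rsqrt r a = a"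
proof -
  let ?c = "msqrt 1 (- ((1 / r) *\<^sub>R a))"
  have "?c * ?c = (1 / r) *\<^sub>R a" using msqrt_eq[OF _ mbound_normalized] by (simp add: algebra_simps)
  then show ?thesis using r by (simp add: rsqrt_def)
qed

lemma rsqrt_intertwine:
  assumes "mbound r (- a') r" "d * a = a' * d" shows "d * rsqrt r a = rsqrt r a' * d"
proof -
  have "mbound 1 (- ((1 / r) *\<^sub>R a')) 1" using mbound_scale[OF assms(1), of "1/r"] r by simp
  from msqrt_intertwine[OF _ mbound_normalized this, of d] assms(2) show ?thesis
    by (simp add: rsqrt_def)
qed

lemma rsqrt_spos: "invol a = a \<Longrightarrow> spos (rsqrt r a)"
  unfolding rsqrt_def
proof (intro spos_scale)
  assume "invol a = a"
  then have "invol (msqrt 1 (- ((1 / r) *\<^sub>R a))) = msqrt 1 (- ((1 / r) *\<^sub>R a))"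
    by (intro msqrt_sa mbound_normalized) auto
  then show "spos (- msqrt 1 (- ((1 / r) *\<^sub>R a)))"
    unfolding spos_def using msqrt_bound[OF _ mbound_normalized] by (auto intro!: exI[of _ 1])
qed (use r in auto)

end

lemma spos_sqrt:
  assumes "spos a"
  obtains b where "spos b" "b * b = a" "\<And>d. d * a = a * d \<Longrightarrow> d * b = b * d"
proof -
  from assms obtain r where r: "r > 0" "mbound r (- a) r" by (auto simp: spos_def)
  show ?thesis
    by (rule that[OF rsqrt_spos[OF r sposD[OF assms]] rsqrt_square[OF r]])
      (rule rsqrt_intertwine[OF r r(2)])
qed

text \<open>For \<open>norm b \<le> 1\<close> the multiplier \<open>u = b + \<i> (1 - s)\<close>, with \<open>1 - s = sqrt (1 - b\<^sup>2)\<close>, is unitary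
  and \<open>u\<^sup>2 + (u\<^sup>*)\<^sup>2 = 2 (2 b\<^sup>2 - 1)\<close>, so \<open>1 - 2 b\<^sup>2\<close> is a contraction.\<close>

lemma mbound_square:
  fixes b :: "'a::cstar_algebra"
  assumes b: "invol b = b" and n: "norm b \<le> 1"
  shows "mbound 1 (- (2 *\<^sub>R (b * b))) 1"
proof -
  have "norm (b * b) \<le> 1" using n b by (simp add: norm_square_sa mult_le_one)
  then have B: "mbound 0 (b * b) 1" by (rule mbound_element)
  define s where "s = msqrt 0 (b * b)"
  have sq: "s * s = s + s - b * b" using msqrt_eq[OF _ B] by (simp add: s_def scaleR_2 algebra_simps)
  have sa: "invol s = s" unfolding s_def using b by (intro msqrt_sa B) auto
  have com: "b * s = s * b" unfolding s_def by (intro msqrt_intertwine B) (auto simp: mult.assoc)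
  have com': "b * (s * y) = s * (b * y)" for y by (metis com mult.assoc)
  have sq': "s * (s * y) = s * y + s * y - b * (b * y)" for y
    by (metis sq left_diff_distrib distrib_right mult.assoc)
  have unitary: "norm (b * y + cscale k (y - s * y)) = norm y" if k: "k = \<i> \<or> k = - \<i>" for y k
  proof -
    let ?z = "b * y + cscale k (y - s * y)"
    have "invol ?z * ?z = invol y * y"
      using k by (auto simp: b sa algebra_simps sq sq' com com' cscale_add_right cscale_diff cscale_cscale cscale_one)
    then have "norm ?z * norm ?z = norm y * norm y" by (metis cstar_identity)
    then show ?thesis by (metis norm_ge_zero real_sqrt_mult_self real_sqrt_abs2 abs_of_nonneg)
  qed
  show ?thesis unfolding mbound_def
  proof
    fix y
    let ?u = "\<lambda>k y. b * y + cscale k (y - s * y)"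
    have "?u \<i> (?u \<i> y) + ?u (- \<i>) (?u (- \<i>) y) = - 2 *\<^sub>R (1 *\<^sub>R y + - (2 *\<^sub>R (b * b)) * y)"
      by (simp add: algebra_simps sq sq' com com' cscale_add_right cscale_diff cscale_cscale cscale_one scaleR_2)
    then have "2 * norm (1 *\<^sub>R y + - (2 *\<^sub>R (b * b)) * y) = norm (?u \<i> (?u \<i> y) + ?u (- \<i>) (?u (- \<i>) y))"
      by simp
    also have "\<dots> \<le> norm (?u \<i> (?u \<i> y)) + norm (?u (- \<i>) (?u (- \<i>) y))" by (rule norm_triangle_ineq)
    also have "\<dots> = 2 * norm y" by (simp only: unitary disj_commute simp_thms)
    finally show "norm (1 *\<^sub>R y + - (2 *\<^sub>R (b * b)) * y) \<le> 1 * norm y" by simp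
  qed
qed

lemma mbound_square':
  assumes "invol b = b" "norm b * norm b \<le> r" "r > 0"
  shows "mbound r (- (b * b)) r"
proof -
  let ?c = "(1 / sqrt r) *\<^sub>R b"
  have "norm b \<le> sqrt r" using assms by (simp add: real_le_rsqrt power2_eq_square)
  then have "norm ?c \<le> 1" using assms by (simp add: divide_simps)
  then have "mbound 1 (- (2 *\<^sub>R (?c * ?c))) 1" using assms by (intro mbound_square) auto
  from mbound_scale[OF this, of "r/2"] have "mbound (r / 2) (- (b * b)) (r / 2)"
    using assms by (simp add: divide_simps)
  then show ?thesis by (rule mbound_mono) (use assms in simp)
qed

lemma spos_square:
  assumes "invol b = b" shows "spos (b * b)"
  unfolding spos_def
proof
  have "norm b * norm b \<le> norm b * norm b + 1" by simp
  then have "mbound (norm b * norm b + 1) (- (b * b)) (norm b * norm b + 1)"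
    by (rule mbound_square'[OF assms]) (simp add: add_nonneg_pos)
  then show "\<exists>r>0. mbound r (- (b * b)) r" by (auto intro!: exI[of _ "norm b * norm b + 1"] add_nonneg_pos)
qed (use assms in simp)

text \<open>Writing \<open>a\<close> as a square frees the radius from the existential witness in
  \<open>spos\<close>; limits need one radius for a whole sequence.\<close>

lemma spos_mbound:
  assumes "spos a" "norm a \<le> r" "r > 0" shows "mbound r (- a) r"
proof -
  obtain b where b: "spos b" "b * b = a" using spos_sqrt[OF assms(1)] by blast
  then show ?thesis using mbound_square'[of b r] assms norm_square_sa[of b] by simp
qed

lemma spos_tendsto:
  assumes "\<And>n. spos (f n)" "f \<longlonglongrightarrow> l" shows "spos l"
proof -
  obtain K where K: "K > 0" "\<And>n. norm (f n) \<le> K"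
    using convergent_imp_Bseq[of f] assms(2) by (auto simp: convergent_def Bseq_def)
  have "mbound K (- l) K"
    by (rule mbound_tendsto[of "\<lambda>_. K" "\<lambda>n. - f n" "\<lambda>_. K"])
      (use spos_mbound[OF assms(1) K(2) K(1)] assms(2) in \<open>auto intro: tendsto_intros\<close>)
  moreover have "invol l = l"
    using tendsto_invol[OF assms(2)] assms LIMSEQ_unique by auto
  ultimately show ?thesis using K(1) by (auto simp: spos_def)
qed

text \<open>\<open>b\<close> is the real part of \<open>z = b + \<i> c\<close>, so its norm is at
  most that of \<open>z\<close>, while commutativity gives
  \<open>invol z * z = b * b + c * c\<close>.\<close>

lemma sum_squares_norm:
  fixes b :: "'a::cstar_algebra"
  assumes "invol b = b" "invol c = c" "b * c = c * b"
  shows "norm b * norm b \<le> norm (b * b + c * c)"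
proof -
  let ?z = "b + cscale \<i> c"
  have "invol ?z * ?z = b * b + c * c"
    using assms by (simp add: algebra_simps cscale_diff)
  then have z: "norm ?z * norm ?z = norm (b * b + c * c)" by (metis cstar_identity)
  have "?z + invol ?z = 2 *\<^sub>R b" using assms by (simp add: scaleR_2)
  then have "2 * norm b = norm (?z + invol ?z)" by simp
  also have "\<dots> \<le> norm ?z + norm (invol ?z)" by (rule norm_triangle_ineq)
  also have "\<dots> = 2 * norm ?z" by (simp only: norm_invol)
  finally have "norm b \<le> norm ?z" by simp
  then show ?thesis unfolding z[symmetric] by (simp add: mult_mono)
qed

lemma spos_antisym:
  assumes "spos a" "spos (- a)" shows "a = 0"
proof -
  obtain b where b: "spos b" "b * b = a" "\<And>d. d * a = a * d \<Longrightarrow> d * b = b * d"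
    using spos_sqrt[OF assms(1)] by blast
  obtain c where c: "spos c" "c * c = - a" "\<And>d. d * - a = - a * d \<Longrightarrow> d * c = c * d"
    using spos_sqrt[OF assms(2)] by blast
  have "b * a = a * b" using b(2) mult.assoc by metis
  then have "b * c = c * b" by (intro c(3)) simp
  then have "norm b * norm b \<le> norm (b * b + c * c)" by (intro sum_squares_norm) (simp_all add: b(1) c(1))
  then have "b = 0" using b(2) c(2) by (simp add: mult_le_0_iff)
  then show ?thesis using b(2) by simp
qed

lemma spos_mult:
  assumes "spos a" "spos b" "a * b = b * a" shows "spos (a * b)"
proof -
  obtain \<alpha> where \<alpha>: "spos \<alpha>" "\<alpha> * \<alpha> = a" "\<And>d. d * a = a * d \<Longrightarrow> d * \<alpha> = \<alpha> * d"
    using spos_sqrt[OF assms(1)] by blast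
  obtain \<beta> where \<beta>: "spos \<beta>" "\<beta> * \<beta> = b" "\<And>d. d * b = b * d \<Longrightarrow> d * \<beta> = \<beta> * d"
    using spos_sqrt[OF assms(2)] by blast
  have "\<alpha> * b = b * \<alpha>" using \<alpha>(3)[of b] assms(3) by simp
  then have com: "\<alpha> * \<beta> = \<beta> * \<alpha>" by (rule \<beta>(3))
  then have "a * b = (\<alpha> * \<beta>) * (\<alpha> * \<beta>)" using \<alpha>(2) \<beta>(2) by (metis mult.assoc)
  moreover have "invol (\<alpha> * \<beta>) = \<alpha> * \<beta>" using \<alpha>(1) \<beta>(1) com by simp
  ultimately show ?thesis using spos_square by metis
qed

lemma spos_add_eq_0:
  assumes "spos a" "spos b" "a + b = 0" shows "a = 0"
  using assms spos_antisym[of a] by (metis add_eq_0_iff)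

text \<open>For \<open>h = b - c\<close>, the relation \<open>h * (b + c) = 0\<close> makes the
  positive elements \<open>h * h * b\<close> and \<open>h * h * c\<close> sum to \<open>0\<close>.
  Both vanish, and with them the cube of \<open>h\<close>.\<close>

lemma spos_sqrt_unique:
  assumes "spos b" "spos c" "b * c = c * b" "b * b = c * c" shows "b = c"
proof -
  define h where "h = b - c"
  have h: "invol h = h" "h * b = b * h" "h * c = c * h"
    using assms by (auto simp: h_def algebra_simps)
  have s: "spos (h * h * b)" "spos (h * h * c)"
    by (rule spos_mult[OF spos_square[OF h(1)] assms(1)], metis h(2) mult.assoc)
      (rule spos_mult[OF spos_square[OF h(1)] assms(2)], metis h(3) mult.assoc)
  have "h * (b + c) = 0" using assms by (simp add: h_def algebra_simps)
  then have z: "h * h * b + h * h * c = 0" by (metis distrib_left mult.assoc mult_zero_right)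
  then have "h * h * b = 0" using spos_add_eq_0 s by blast
  with z have "h * h * (b - c) = 0" by (simp add: right_diff_distrib)
  then have "h * (h * h) = 0" by (simp add: h_def[symmetric] mult.assoc)
  then show ?thesis using cube_sa_eq_0[OF h(1)] by (simp add: h_def)
qed

text \<open>With \<open>k\<close> the absolute value of \<open>p\<close>, both
  \<open>k * (p * p)\<close> and \<open>p * (p * p)\<close> are positive roots of the sixth power of
  \<open>p\<close>, hence equal. Expanding the cube of \<open>k - p\<close> then gives
  \<open>0\<close>.\<close>

lemma spos_of_cube:
  assumes p: "invol p = p" and c: "spos (p * (p * p))" shows "spos p"
proof -
  obtain k where k: "spos k" "k * k = p * p" "\<And>d. d * (p * p) = p * p * d \<Longrightarrow> d * k = k * d"
    using spos_sqrt[OF spos_square[OF p]] by blast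
  have com: "k * p = p * k" using k(3)[of p] by (simp add: mult.assoc)
  have com': "k * (p * y) = p * (k * y)" for y by (metis com mult.assoc)
  have kk: "k * (k * y) = p * (p * y)" for y by (metis k(2) mult.assoc)
  have "k * (p * p) = p * (p * p)"
  proof (rule spos_sqrt_unique)
    show "spos (k * (p * p))" by (intro spos_mult k spos_square p) (simp add: com com' mult.assoc)
  qed (use c in \<open>simp_all add: com com' kk k(2) mult.assoc\<close>)
  then have "(k - p) * ((k - p) * (k - p)) = 0"
    by (simp add: algebra_simps com com' kk k(2))
  then have "k - p = 0" using cube_sa_eq_0[of "k - p"] p k(1) by simp
  with k(1) show ?thesis by simp
qed

text \<open>The parts are half of \<open>k + h\<close> and of \<open>k - h\<close>, with
  \<open>k\<close> the absolute value of \<open>h\<close>. Their orthogonality makes the cube of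
  \<open>p\<close> the product of \<open>p * p\<close> and \<open>k\<close>, hence positive, and
  \<open>spos_of_cube\<close> applies; likewise for \<open>q\<close>.\<close>

lemma spos_decomposition:
  assumes h: "invol h = h"
  obtains p q where "spos p" "spos q" "h = p - q" "p * q = 0" "q * p = 0"
    "\<And>d. d * h = h * d \<Longrightarrow> d * p = p * d" "\<And>d. d * h = h * d \<Longrightarrow> d * q = q * d"
proof -
  obtain k where k: "spos k" "k * k = h * h" "\<And>d. d * (h * h) = h * h * d \<Longrightarrow> d * k = k * d"
    using spos_sqrt[OF spos_square[OF h]] by blast
  define p where "p = (1/2) *\<^sub>R (k + h)"
  define q where "q = (1/2) *\<^sub>R (k - h)"
  have com: "h * k = k * h" using k(3)[of h] by (simp add: mult.assoc)
  have pq: "p * q = 0" "q * p = 0" unfolding p_def q_def using com k(2) by (simp_all add: algebra_simps)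
  have "(k + h) + (k - h) = k + k" "(k + h) - (k - h) = h + h" by simp_all
  then have "k = p + q" and hpq: "h = p - q" unfolding p_def q_def
    by (simp_all only: flip: scaleR_right_distrib scaleR_right_diff_distrib) simp_all
  have sa: "invol p = p" "invol q = q" using h k(1) by (simp_all add: p_def q_def)
  have E: "p * k = p * p" "k * p = p * p" "q * k = q * q" "k * q = q * q"
    by (simp_all add: \<open>k = p + q\<close> distrib_left distrib_right pq)
  have C: "p * p * k = p * (p * p)" "k * (p * p) = p * (p * p)"
    "q * q * k = q * (q * q)" "k * (q * q) = q * (q * q)"
    using E by (metis mult.assoc)+
  then have "spos (p * p * k)" "spos (q * q * k)"
    using spos_mult[OF spos_square[OF sa(1)] k(1)] spos_mult[OF spos_square[OF sa(2)] k(1)] by simp_all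
  then have "spos p" "spos q" using spos_of_cube sa C by simp_all
  moreover have "d * k = k * d" if "d * h = h * d" for d
    by (rule k(3)) (metis that mult.assoc)
  then have "d * p = p * d" "d * q = q * d" if "d * h = h * d" for d
    using that by (simp_all add: p_def q_def algebra_simps)
  ultimately show ?thesis using that pq hpq by blast
qed

text \<open>With \<open>u\<^sub>-\<close> the negative part of \<open>c\<^sup>* c\<close> and \<open>d = c u\<^sub>-\<close>, we have \<open>d\<^sup>* d = - u\<^sub>-\<^sup>3\<close>, hence \<open>d d\<^sup>*\<close> is positive.
  Since \<open>d\<close> intertwines \<open>d\<^sup>* d\<close> with \<open>d d\<^sup>*\<close>, it also intertwines their absolute values \<open>- d\<^sup>* d\<close> and
  \<open>d d\<^sup>*\<close>, which forces \<open>d = 0\<close>.\<close>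

lemma spos_star_square: "spos (invol c * c)"
proof -
  define u where "u = invol c * c"
  have "invol u = u" by (simp add: u_def)
  then obtain p q where pq: "spos p" "spos q" "u = p - q" "p * q = 0" "q * p = 0"
    using spos_decomposition by metis
  define d where "d = c * q"
  define w where "w = q * (q * q)"
  define v where "v = d * invol d"
  have w: "spos w" unfolding w_def by (intro spos_mult pq spos_square) (simp_all add: pq mult.assoc)
  have "invol d * d = q * u * q" unfolding d_def u_def using pq by (simp add: mult.assoc)
  also have "\<dots> = - w" unfolding w_def by (simp add: pq algebra_simps)
  finally have dd: "invol d * d = - w" .
  \<comment> \<open>Up to real factors, the real and imaginary parts of \<open>d\<close>:
    \<open>x * x + y * y\<close> is twice \<open>v + invol d * d\<close>, which exhibits
    \<open>v\<close> as a sum of positive terms.\<close>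
  define x where "x = d + invol d"
  define y where "y = cscale \<i> (d - invol d)"
  have "v = (1/2) *\<^sub>R (x * x + y * y) + w"
  proof -
    have "x * x + y * y = 2 *\<^sub>R (v + invol d * d)"
      unfolding x_def y_def v_def by (simp add: algebra_simps scaleR_2 cscale_diff)
    then show ?thesis by (simp add: dd)
  qed
  moreover have "invol x = x" "invol y = y" by (auto simp: x_def y_def cscale_diff)
  ultimately have v: "spos v" using w by (auto intro!: spos_add spos_scale spos_square)
  have vd: "v * d = - (d * w)" unfolding v_def using dd by (simp add: mult.assoc)
  have "v * v * d = d * (w * w)" 
  proof -
    have "v * (d * w) = - (d * w * w)" by (simp add: vd flip: mult.assoc)
    then show ?thesis by (simp add: vd mult.assoc)
  qed
  \<comment> \<open>One radius serves both squares, so that \<open>d\<close> intertwines their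
    roots; by uniqueness these roots are \<open>w\<close> and \<open>v\<close>.\<close>
  define r where "r = norm (w * w) + norm (v * v) + 1"
  have r: "r > 0" "mbound r (- (w * w)) r" "mbound r (- (v * v)) r"
    by (simp add: r_def add_nonneg_pos)
      (rule spos_mbound; simp add: r_def add_nonneg_pos spos_square v w)+
  have root: "rsqrt r (a * a) = a" if "mbound r (- (a * a)) r" "spos a" for a
  proof (rule spos_sqrt_unique)
    show "spos (rsqrt r (a * a))" by (intro rsqrt_spos r that) (simp add: that)
    show "rsqrt r (a * a) * a = a * rsqrt r (a * a)"
      by (rule rsqrt_intertwine[symmetric]) (simp_all add: that r mult.assoc)
  qed (use that r rsqrt_square in auto)
  have "d * rsqrt r (w * w) = rsqrt r (v * v) * d"
    by (rule rsqrt_intertwine) (simp_all add: r \<open>v * v * d = d * (w * w)\<close>)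
  then have "d * w = v * d" by (simp add: root r v w)
  with vd have "v * d + v * d = 0" by (metis add.left_inverse)
  then have "v * d = 0" by (simp flip: scaleR_2)
  then have "(invol d * d) * (invol d * d) = 0" by (simp add: v_def mult.assoc)
  then have "w * w = 0" by (simp add: dd)
  then have "w = 0" using square_sa_eq_0[of w] w by simp
  then have "q = 0" using cube_sa_eq_0[of q] pq(2) by (simp add: w_def)
  with pq show ?thesis by (simp add: u_def)
qed

lemma positive_iff_spos: "positive a \<longleftrightarrow> spos a"
  by (metis positive_def spos_star_square spos_sqrt sposD)

subsection \<open>Maximal abelian self-adjoint subalgebras\<close>

definition commutant :: "'a::cstar_algebra set \<Rightarrow> 'a set" where
  "commutant S = {y. \<forall>x\<in>S. x * y = y * x}"

lemma commutant_antimono: "S \<subseteq> T \<Longrightarrow> commutant T \<subseteq> commutant S"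
  by (auto simp: commutant_def)

lemma abelian_iff_commutant: "abelian S \<longleftrightarrow> S \<subseteq> commutant S"
  by (auto simp: commutant_def abelian_def)

lemma subset_commutant_commutant: "S \<subseteq> commutant (commutant S)"
  by (auto simp: commutant_def)

lemma star_subalgebraD:
  assumes "star_subalgebra S"
  shows "0 \<in> S" "x \<in> S \<Longrightarrow> y \<in> S \<Longrightarrow> x + y \<in> S" "x \<in> S \<Longrightarrow> y \<in> S \<Longrightarrow> x * y \<in> S"
    "x \<in> S \<Longrightarrow> cscale c x \<in> S" "x \<in> S \<Longrightarrow> invol x \<in> S"
  using assms by (auto simp: star_subalgebra_def)

lemma star_subalgebra_diff:
  assumes "star_subalgebra S" "x \<in> S" "y \<in> S" shows "x - y \<in> S"
proof -
  have "x + cscale (-1) y \<in> S" by (intro star_subalgebraD[OF assms(1)] assms)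
  then show ?thesis by (simp add: cscale_one)
qed

lemma star_subalgebra_commutant:
  assumes "\<And>x. x \<in> S \<Longrightarrow> invol x \<in> S" shows "star_subalgebra (commutant S)"
proof -
  have "x * (y * z) = y * z * x" if "y \<in> commutant S" "z \<in> commutant S" "x \<in> S" for x y z
  proof -
    have "x * y = y * x" "x * z = z * x" using that by (auto simp: commutant_def)
    then show ?thesis by (metis mult.assoc)
  qed
  moreover have "x * invol y = invol y * x" if "y \<in> commutant S" "x \<in> S" for x y
  proof -
    have "invol x * y = y * invol x" using that assms unfolding commutant_def by blast
    then show ?thesis by (metis invol_mult invol_invol)
  qed
  ultimately show ?thesis
    unfolding star_subalgebra_def by (auto simp: commutant_def distrib_left distrib_right)
qed

lemma invol_mem_commutant:
  assumes "\<And>x. x \<in> S \<Longrightarrow> invol x \<in> S" "y \<in> commutant S" shows "invol y \<in> commutant S"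
  using star_subalgebra_commutant[OF assms(1)] assms(2) by (auto simp: star_subalgebra_def)

lemma star_subalgebra_decompose:
  assumes S: "star_subalgebra S" and "y + invol y \<in> S" "cscale \<i> (y - invol y) \<in> S"
  shows "y \<in> S"
proof -
  have "cscale (1/2) (y + invol y) + cscale (- \<i> / 2) (cscale \<i> (y - invol y)) \<in> S"
    using assms unfolding star_subalgebra_def by blast
  moreover have "cscale (1/2) (y + invol y) + cscale (- \<i> / 2) (cscale \<i> (y - invol y)) = y"
    using cscale_add_left[of "1/2" "1/2" y]
    by (simp add: cscale_cscale cscale_diff cscale_add_right cscale_one)
  ultimately show ?thesis by simp
qed

text \<open>For self-adjoint \<open>z\<close> commuting with \<open>M\<close>, the bicommutant of
  \<open>insert z M\<close> is an abelian star subalgebra containing \<open>M\<close>, hence equal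
  to \<open>M\<close>. Other elements are split into real and imaginary parts.\<close>

lemma masa_memI:
  assumes M: "masa M" and y: "\<And>x. x \<in> M \<Longrightarrow> x * y = y * x" shows "y \<in> M"
proof -
  have sM: "star_subalgebra M" and aM: "abelian M" using M by (auto simp: masa_def)
  then have iM: "\<And>x. x \<in> M \<Longrightarrow> invol x \<in> M" by (auto simp: star_subalgebra_def)
  have *: "z \<in> M" if z: "z \<in> commutant M" "invol z = z" for z
  proof -
    let ?T = "insert z M"
    have iT: "\<And>x. x \<in> ?T \<Longrightarrow> invol x \<in> ?T" using iM z(2) by auto
    have sub: "?T \<subseteq> commutant ?T" using z aM by (auto simp: commutant_def abelian_def)
    then have "abelian (commutant (commutant ?T))"
      unfolding abelian_iff_commutant by (intro commutant_antimono)
    moreover have "star_subalgebra (commutant (commutant ?T))"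
      by (intro star_subalgebra_commutant invol_mem_commutant iT)
    moreover have "?T \<subseteq> commutant (commutant ?T)" by (rule subset_commutant_commutant)
    ultimately show ?thesis using M unfolding masa_def by blast
  qed
  have "star_subalgebra (commutant M)" using iM by (rule star_subalgebra_commutant)
  moreover have "y \<in> commutant M" using y by (simp add: commutant_def)
  ultimately have "y + invol y \<in> commutant M" "cscale \<i> (y - invol y) \<in> commutant M"
    by (simp_all only: star_subalgebra_diff star_subalgebraD)
  then have "y + invol y \<in> M" "cscale \<i> (y - invol y) \<in> M"
    by (auto intro!: * simp: cscale_diff)
  then show ?thesis by (rule star_subalgebra_decompose[OF sM])
qed

lemma abelian_insert:
  assumes "abelian T" "\<And>t. t \<in> T \<Longrightarrow> t * y = y * t" shows "abelian (insert y T)"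
  unfolding abelian_def
proof (intro ballI)
  fix a b assume a: "a \<in> insert y T" and b: "b \<in> insert y T"
  consider "a = b" | "a = y" "b \<in> T" | "b = y" "a \<in> T" | "a \<in> T" "b \<in> T" using a b by blast
  then show "a * b = b * a"
  proof cases
    case 2 then show ?thesis using assms(2)[of b] by simp
  next
    case 3 then show ?thesis using assms(2)[of a] by simp
  next
    case 4 then show ?thesis using assms(1) unfolding abelian_def by blast
  qed simp
qed

text \<open>Zorn's lemma relative to \<open>X\<close>, because it serves twice: with the
  self-adjoint elements to build masas, and with the projections over an element to find a least
  one.\<close>

lemma maximal_commuting:
  fixes S X :: "'a::cstar_algebra set"
  assumes "S \<subseteq> X" "abelian S"
  obtains T where "S \<subseteq> T" "T \<subseteq> X" "abelian T"
    "\<forall>y\<in>X. (\<forall>t\<in>T. t * y = y * t) \<longrightarrow> y \<in> T"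
proof -
  let ?A = "{T. S \<subseteq> T \<and> T \<subseteq> X \<and> abelian T}"
  have "\<exists>T\<in>?A. \<forall>T'\<in>?A. T \<subseteq> T' \<longrightarrow> T' = T"
  proof (rule subset_Zorn_nonempty)
    fix C assume C: "C \<noteq> {}" "subset.chain ?A C"
    have "x * y = y * x" if "x \<in> T" "y \<in> T'" "T \<in> C" "T' \<in> C" for x y T T'
    proof -
      have "T \<subseteq> T' \<or> T' \<subseteq> T" using C that by (simp add: subset_chain_def)
      moreover have "abelian T" "abelian T'" using C that by (auto simp: subset_chain_def)
      ultimately show ?thesis using that unfolding abelian_def by blast
    qed
    then have "abelian (\<Union>C)" unfolding abelian_def by (meson UnionE)
    moreover have "C \<subseteq> ?A" using C(2) by (simp add: subset_chain_def)
    then have *: "S \<subseteq> T" "T \<subseteq> X" if "T \<in> C" for T using that by auto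
    from C(1) obtain T where "T \<in> C" by blast
    then have "S \<subseteq> \<Union>C" using *(1) by blast
    moreover have "\<Union>C \<subseteq> X" using *(2) by blast
    ultimately show "\<Union>C \<in> ?A" by simp
  qed (use assms in auto)
  then obtain T where "T \<in> ?A" and max: "\<forall>T'\<in>?A. T \<subseteq> T' \<longrightarrow> T' = T" by (elim bexE)
  then have T: "S \<subseteq> T" "T \<subseteq> X" "abelian T" by simp_all
  show ?thesis
  proof (rule that[OF T])
    have "y \<in> T" if y: "y \<in> X" "\<forall>t\<in>T. t * y = y * t" for y
    proof -
      have "abelian (insert y T)" using T(3) y(2) by (intro abelian_insert) auto
      moreover have "S \<subseteq> insert y T" "insert y T \<subseteq> X" using T(1,2) y(1) by blast+
      ultimately have "insert y T \<in> ?A" by simp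
      from bspec[OF max this] show "y \<in> T" by blast
    qed
    then show "\<forall>y\<in>X. (\<forall>t\<in>T. t * y = y * t) \<longrightarrow> y \<in> T" by blast
  qed
qed

text \<open>The masa is the commutant of a maximal commuting set \<open>T\<close> of self-adjoint
  elements. By maximality the self-adjoint elements of this commutant lie in \<open>T\<close>, so
  the commutant is abelian.\<close>

lemma masa_extending:
  fixes S :: "'a::cstar_algebra set"
  assumes "\<And>x. x \<in> S \<Longrightarrow> invol x = x" "abelian S"
  obtains M where "masa M" "S \<subseteq> M"
proof -
  have sub: "S \<subseteq> {x. invol x = x}" using assms by auto
  obtain T where T: "S \<subseteq> T" "T \<subseteq> {x. invol x = x}" "abelian T"
    and max: "\<forall>y\<in>{x. invol x = x}. (\<forall>t\<in>T. t * y = y * t) \<longrightarrow> y \<in> T"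
    by (rule maximal_commuting[OF sub assms(2)])
  have iT: "\<And>x. x \<in> T \<Longrightarrow> invol x \<in> T" using T by auto
  have sT: "star_subalgebra (commutant T)" using iT by (rule star_subalgebra_commutant)
  have "T \<subseteq> commutant T" using T by (auto simp: commutant_def abelian_def)
  have cc: "commutant T \<subseteq> commutant (commutant T)"
  proof
    fix y assume y: "y \<in> commutant T"
    have sa: "z \<in> commutant (commutant T)" if "z \<in> commutant T" "invol z = z" for z
      using max that by (auto simp: commutant_def)
    have "invol y \<in> commutant T" using y iT by (intro invol_mem_commutant)
    then have "y + invol y \<in> commutant T" "cscale \<i> (y - invol y) \<in> commutant T"
      by (simp_all only: star_subalgebra_diff[OF sT] star_subalgebraD[OF sT] y)
    then have "y + invol y \<in> commutant (commutant T)" "cscale \<i> (y - invol y) \<in> commutant (commutant T)"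
      by (auto intro!: sa simp: cscale_diff)
    then show "y \<in> commutant (commutant T)"
      by (rule star_subalgebra_decompose[rotated])
        (intro star_subalgebra_commutant invol_mem_commutant iT)
  qed
  have "masa (commutant T)" unfolding masa_def
  proof (intro conjI allI impI sT)
    show "abelian (commutant T)" using cc by (simp add: abelian_iff_commutant)
    fix N assume "star_subalgebra N \<and> abelian N \<and> commutant T \<subseteq> N"
    then have "N \<subseteq> commutant N" "T \<subseteq> N" "commutant T \<subseteq> N"
      using \<open>T \<subseteq> commutant T\<close> by (auto simp: abelian_iff_commutant)
    then show "N = commutant T" using commutant_antimono[of T N] by blast
  qed
  with that T(1) \<open>T \<subseteq> commutant T\<close> show ?thesis by blast
qed

text \<open>Here \<open>s\<close> is \<open>1 - sqrt (1 - g)\<close>, so the difference is the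
  square of the self-adjoint \<open>x - x * s\<close>.\<close>

lemma spos_mult_contraction_diff:
  assumes x: "invol x = x" and g: "spos g" "norm g \<le> 1" and com: "x * g = g * x"
  shows "spos (x * x - x * x * g)"
proof -
  have B: "mbound 0 g 1" using g(2) by (rule mbound_element)
  define s where "s = msqrt 0 g"
  have sq: "s * s = s + s - g" using msqrt_eq[OF _ B] by (simp add: s_def scaleR_2 algebra_simps)
  have sa: "invol s = s" unfolding s_def using g(1) by (intro msqrt_sa B) auto
  have c: "x * s = s * x" unfolding s_def by (intro msqrt_intertwine B com) auto
  have "invol (x - x * s) = x - x * s" using x sa c by simp
  from spos_square[OF this] have "spos ((x - x * s) * (x - x * s))" .
  moreover have "(x - x * s) * (x - x * s) = x * x - x * (x * (s + s - s * s))"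
  proof -
    have "s * (x * y) = x * (s * y)" for y by (metis c mult.assoc)
    then show ?thesis by (simp add: algebra_simps flip: c)
  qed
  ultimately show ?thesis by (simp add: sq mult.assoc)
qed

lemma spos_diff_contraction:
  assumes "spos x" "spos g" "norm g \<le> 1" "x * g = g * x" shows "spos (x - x * g)"
proof -
  obtain y where y: "spos y" "y * y = x" "\<And>d. d * x = x * d \<Longrightarrow> d * y = y * d"
    using spos_sqrt[OF assms(1)] by blast
  have "y * g = g * y" using y(3)[of g] assms(4) by simp
  then have "spos (y * y - y * y * g)" using y(1) assms by (intro spos_mult_contraction_diff) auto
  then show ?thesis by (simp add: y(2))
qed

lemma projection_spos: "is_projection e \<Longrightarrow> spos e"
  unfolding is_projection_def by (metis spos_square)

lemma projection_norm: "is_projection e \<Longrightarrow> norm (e::'a::cstar_algebra) \<le> 1"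
proof -
  assume "is_projection e"
  then have "norm e = norm e * norm e" unfolding is_projection_def by (metis norm_square_sa)
  then show ?thesis by auto
qed

section \<open>Order and support projections in a fixed masa\<close>

locale masa_algebra =
  fixes M :: "'a::cstar_algebra set"
  assumes masa: "masa M"
begin

lemma starM: "star_subalgebra M" using masa by (simp add: masa_def)

lemma scaleR_mem: "x \<in> M \<Longrightarrow> r *\<^sub>R x \<in> M"
  using star_subalgebraD(4)[OF starM, of x "complex_of_real r"] by (simp add: cscale_of_real)

lemma uminus_mem: "x \<in> M \<Longrightarrow> - x \<in> M"
  using scaleR_mem[of x "-1"] by simp

lemmas mem = star_subalgebraD[OF starM] star_subalgebra_diff[OF starM] scaleR_mem uminus_mem

lemma comm: "x \<in> M \<Longrightarrow> y \<in> M \<Longrightarrow> x * y = y * x"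
  using masa by (simp add: masa_def abelian_def)

lemma lcomm: "x \<in> M \<Longrightarrow> y \<in> M \<Longrightarrow> x * (y * z) = y * (x * z)"
  using comm[of x y] by (metis mult.assoc)

lemma sqrt_mem:
  assumes "a \<in> M" "spos a" obtains b where "b \<in> M" "spos b" "b * b = a"
proof -
  obtain b where b: "spos b" "b * b = a" "\<And>d. d * a = a * d \<Longrightarrow> d * b = b * d"
    using spos_sqrt[OF assms(2)] by blast
  have "b \<in> M" by (rule masa_memI[OF masa], rule b(3), rule comm[OF _ assms(1)])
  with b that show ?thesis by blast
qed

lemma decomposition_mem:
  assumes "h \<in> M" "invol h = h"
  obtains p q where "p \<in> M" "q \<in> M" "spos p" "spos q" "h = p - q" "p * q = 0" "q * p = 0"
proof -
  obtain p q where pq: "spos p" "spos q" "h = p - q" "p * q = 0" "q * p = 0"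
    "\<And>d. d * h = h * d \<Longrightarrow> d * p = p * d" "\<And>d. d * h = h * d \<Longrightarrow> d * q = q * d"
    using spos_decomposition[OF assms(2)] by blast
  have "p \<in> M" by (rule masa_memI[OF masa], rule pq(6), rule comm[OF _ assms(1)])
  moreover have "q \<in> M" by (rule masa_memI[OF masa], rule pq(7), rule comm[OF _ assms(1)])
  ultimately show ?thesis using that pq by blast
qed

text \<open>Norm closedness comes from \<open>M\<close> being its own commutant.\<close>

lemma lim_mem:
  assumes "\<And>n. f n \<in> M" "f \<longlonglongrightarrow> l" shows "l \<in> M"
proof (rule masa_memI[OF masa])
  fix x assume x: "x \<in> M"
  have "(\<lambda>n. x * f n) \<longlonglongrightarrow> x * l" "(\<lambda>n. f n * x) \<longlonglongrightarrow> l * x"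
    by (intro tendsto_intros assms)+
  then show "x * l = l * x" using comm[OF x assms(1)] LIMSEQ_unique by simp
qed

lemma spos_mult_mem: "a \<in> M \<Longrightarrow> b \<in> M \<Longrightarrow> spos a \<Longrightarrow> spos b \<Longrightarrow> spos (a * b)"
  by (intro spos_mult comm)

lemma mult_eq_0_mem:
  assumes "z \<in> M" "h \<in> M" "invol z = z" "invol h = h" "z * (h * h) = 0" shows "z * h = 0"
proof -
  have "(z * h) * (z * h) = z * (z * (h * h))" by (simp only: mult.assoc lcomm[OF assms(2,1)])
  then have "(z * h) * (z * h) = 0" by (simp add: assms)
  moreover have "invol (z * h) = z * h" using assms comm by simp
  ultimately show ?thesis using square_sa_eq_0 by blast
qed

text \<open>Multiplying \<open>(b - c) * (b + c)\<close> by the square of the negative part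
  \<open>q\<close> of \<open>b - c\<close> gives an element that is both positive and negative. So
  the cube of \<open>q\<close> annihilates \<open>b\<close> and \<open>c\<close>, which forces
  \<open>q = 0\<close>.\<close>

lemma sqrt_mono:
  assumes "b \<in> M" "c \<in> M" "spos b" "spos c" "spos (b * b - c * c)"
  shows "spos (b - c)"
proof -
  obtain p q where pq: "p \<in> M" "q \<in> M" "spos p" "spos q" "b - c = p - q" "p * q = 0" "q * p = 0"
    by (rule decomposition_mem[of "b - c"]) (use assms mem in auto)
  let ?q = "q * (q * q)"
  have q: "?q \<in> M" "spos ?q" using pq by (auto intro!: spos_mult_mem mem)
  have "b * b - c * c = (b - c) * (b + c)" using comm[OF assms(1,2)] by (simp add: algebra_simps)
  then have "q * q * (b * b - c * c) = q * (q * (p - q)) * (b + c)" by (simp only: pq(5) mult.assoc)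
  also have "\<dots> = - (?q * b + ?q * c)" by (simp add: pq algebra_simps)
  finally have "q * q * (b * b - c * c) = - (?q * b + ?q * c)" .
  moreover have "spos (q * q * (b * b - c * c))"
    using assms pq by (intro spos_mult_mem mem) auto
  moreover have s: "spos (?q * b)" "spos (?q * c)" using assms q by (auto intro: spos_mult_mem)
  ultimately have "?q * b + ?q * c = 0" using spos_antisym spos_add by metis
  with s have "?q * b = 0" "?q * c = 0"
    using spos_add_eq_0[of "?q * b" "?q * c"] spos_add_eq_0[of "?q * c" "?q * b"]
    by (simp_all add: add.commute)
  then have "?q * (b - c) = 0" by (simp add: right_diff_distrib)
  then have "(q * q) * (q * q) = 0" by (simp add: pq(5) right_diff_distrib pq(7) mult.assoc)
  then have "q = 0" using square_sa_eq_0[of "q * q"] square_sa_eq_0[of q] pq by simp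
  with pq show ?thesis by simp
qed

lemma monotone_sigma_completeD:
  assumes "monotone_sigma_complete M"
    and "\<And>n. f n \<in> M" "\<And>n. invol (f n) = f n" "\<And>n. spos (f (Suc n) - f n)" "\<And>n. norm (f n) \<le> B"
  obtains s where "s \<in> M" "invol s = s" "\<And>n. spos (s - f n)"
    "\<And>t. t \<in> M \<Longrightarrow> invol t = t \<Longrightarrow> (\<And>n. spos (t - f n)) \<Longrightarrow> spos (t - s)"
proof -
  have "\<exists>s\<in>self_adjoint_part M. (\<forall>n. sa_le (f n) s) \<and>
      (\<forall>t\<in>self_adjoint_part M. (\<forall>n. sa_le (f n) t) \<longrightarrow> sa_le s t)"
    using assms unfolding monotone_sigma_complete_def
    by (auto simp: self_adjoint_part_def sa_le_def positive_iff_spos)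
  then show ?thesis using that
    unfolding self_adjoint_part_def sa_le_def positive_iff_spos by blast
qed

lemma support_projection:
  assumes msc: "monotone_sigma_complete M" and h: "h \<in> M" "invol h = h"
  obtains e where "e \<in> M" "is_projection e" "h * e = h"
    "\<And>z. z \<in> M \<Longrightarrow> invol z = z \<Longrightarrow> z * h = 0 \<Longrightarrow> z * e = 0"
proof -
  define k where "k = 1 / (norm (h * h) + 1)"
  define a where "a = k *\<^sub>R (h * h)"
  have n1: "norm (h * h) + 1 > 0" by (simp add: add_nonneg_pos)
  then have k: "k > 0" by (simp add: k_def)
  have a: "a \<in> M" "spos a" using h k by (auto simp: a_def intro!: mem spos_scale spos_square)
  have na: "norm a \<le> 1" using n1 by (simp add: a_def k_def)
  have "\<exists>f. \<forall>n. (f n \<in> M \<and> spos (f n) \<and> norm (f n) \<le> 1 \<and> (n = 0 \<longrightarrow> f n = a)) \<and>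
      f (Suc n) * f (Suc n) = f n"
  proof (rule dependent_nat_choice)
    fix x and n :: nat assume x: "x \<in> M \<and> spos x \<and> norm x \<le> 1 \<and> (n = 0 \<longrightarrow> x = a)"
    then obtain y where y: "y \<in> M" "spos y" "y * y = x" using sqrt_mem by blast
    then have "norm y * norm y \<le> 1" using norm_square_sa[of y] x by simp
    then have "norm y \<le> 1" by (metis mult_le_one mult_mono' norm_ge_zero linorder_not_le
      less_1_mult order_less_irrefl order_less_le_trans)
    with y show "\<exists>y. (y \<in> M \<and> spos y \<and> norm y \<le> 1 \<and> (Suc n = 0 \<longrightarrow> y = a)) \<and> y * y = x" by auto
  qed (use a na in auto)
  then obtain f where f: "\<And>n. f n \<in> M" "\<And>n. spos (f n)" "\<And>n. norm (f n) \<le> 1" "f 0 = a"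
    "\<And>n. f (Suc n) * f (Suc n) = f n" by blast
  have inc: "spos (f (Suc n) - f n)" for n
    using spos_diff_contraction[OF f(2) f(2) f(3), of "Suc n" "Suc n"] by (simp add: f(5))
  obtain e where e: "e \<in> M" "invol e = e" "\<And>n. spos (e - f n)"
    "\<And>t. t \<in> M \<Longrightarrow> invol t = t \<Longrightarrow> (\<And>n. spos (t - f n)) \<Longrightarrow> spos (t - e)"
    by (rule monotone_sigma_completeD[OF msc, of f 1]) (use f inc in auto)
  \<comment> \<open>Idempotence: by monotonicity of roots, applied one index further, the root
    \<open>g\<close> of \<open>e\<close> is again an upper bound, so \<open>e \<le> g\<close> and
    \<open>e * e \<le> e\<close>. Also \<open>e * e\<close> is an upper bound, which gives the
    converse.\<close>
  have "spos e" using spos_add[OF e(3)[of 0] f(2)[of 0]] by simp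
  then obtain g where g: "g \<in> M" "spos g" "g * g = e" using sqrt_mem e(1) by blast
  have "spos (g - f n)" for n
  proof -
    have "spos (g - f (Suc n))" by (rule sqrt_mono) (simp_all add: g f e)
    from spos_add[OF this inc[of n]] show ?thesis by simp
  qed
  then have "spos (g - e)" by (intro e(4) g sposD)
  then have "spos ((g - e) * (g + e))"
    using g e \<open>spos e\<close> by (intro spos_mult_mem mem spos_add) auto
  then have 1: "spos (e - e * e)" using comm[OF g(1) e(1)] by (simp add: algebra_simps g(3))
  have "spos (e * e - f n)" for n
  proof -
    have "spos ((e - f (Suc n)) * (e + f (Suc n)))"
      using f e \<open>spos e\<close> by (intro spos_mult_mem mem spos_add) auto
    then show ?thesis using comm[OF f(1)[of "Suc n"] e(1)] by (simp add: algebra_simps f(5))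
  qed
  then have "spos (e * e - e)" using e by (intro e(4) mem) auto
  then have ee: "e * e = e" using spos_antisym[OF 1] by simp
  then have pe: "is_projection e" using e by (simp add: is_projection_def)
  \<comment> \<open>Cutting \<open>e - a\<close> by \<open>1 - e\<close> leaves
    \<open>- (a - a * e)\<close>; positivity with both signs yields
    \<open>a = a * e\<close>.\<close>
  have "spos ((e - a) - (e - a) * e)"
    using e(3)[of 0] pe projection_norm \<open>spos e\<close> a e comm[OF a(1) e(1)]
    by (intro spos_diff_contraction) (auto simp: f(4) algebra_simps)
  then have "spos (- (a - a * e))" by (simp add: algebra_simps ee)
  moreover have "spos (a - a * e)"
    using pe projection_norm \<open>spos e\<close> a e comm by (intro spos_diff_contraction) auto
  ultimately have "a - a * e = 0" using spos_antisym by blast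
  then have hhe: "h * h * e = h * h" using k by (simp add: a_def flip: scaleR_right_diff_distrib)
  have "(h - h * e) * (h - h * e) = 0"
  proof -
    have "(h - h * e) * (h - h * e) = h * h - h * h * e"
      using comm[OF h(1) e(1)] hhe ee by (simp add: algebra_simps lcomm[OF e(1) h(1)])
    with hhe show ?thesis by simp
  qed
  then have "h - h * e = 0"
    using square_sa_eq_0[of "h - h * e"] h e comm[OF h(1) e(1)] by simp
  then have he: "h * e = h" by simp
  \<comment> \<open>\<open>z\<close> annihilates every \<open>f n\<close>, so with \<open>b\<close>
    a normalized square of \<open>z\<close> the element \<open>e - e * b\<close> is still an upper
    bound. Minimality of \<open>e\<close> then forces \<open>e * b = 0\<close>.\<close>
  have "z * e = 0" if z: "z \<in> M" "invol z = z" "z * h = 0" for z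
  proof -
    have zf: "z * f n = 0" for n
    proof (induction n)
      case 0
      show ?case using z by (simp add: f(4) a_def flip: mult.assoc)
    next
      case (Suc n)
      show ?case by (rule mult_eq_0_mem) (use z f Suc in auto)
    qed
    define l where "l = 1 / (norm (z * z) + 1)"
    have n2: "norm (z * z) + 1 > 0" by (simp add: add_nonneg_pos)
    define b where "b = l *\<^sub>R (z * z)"
    have l: "l > 0" using n2 by (simp add: l_def)
    have b: "b \<in> M" "spos b" using z l by (auto simp: b_def intro!: mem spos_scale spos_square)
    have nb: "norm b \<le> 1" using n2 by (simp add: b_def l_def)
    have fb: "f n * b = 0" for n
      using zf[of n] comm[OF f(1)[of n] z(1)] by (simp add: b_def flip: mult.assoc)
    have "spos ((e - e * b) - f n)" for n
    proof -
      have "spos ((e - f n) - (e - f n) * b)"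
        using e b nb f by (intro spos_diff_contraction comm mem) auto
      then show ?thesis using fb by (simp add: algebra_simps)
    qed
    then have "spos ((e - e * b) - e)"
      using e(1,2) b sposD[OF b(2)] comm[OF e(1) b(1)] by (intro e(4) mem) auto
    then have "spos (- (e * b))" by simp
    moreover have "spos (e * b)" using e(1) b \<open>spos e\<close> by (intro spos_mult_mem)
    ultimately have "e * b = 0" using spos_antisym by blast
    then have "e * (z * z) = 0" using l by (simp add: b_def)
    then have "e * z = 0" by (rule mult_eq_0_mem[OF e(1) z(1) e(2) z(2)])
    then show ?thesis using comm z e by simp
  qed
  with that[OF e(1) pe he] show ?thesis by blast
qed

lemma support_projection_least:
  assumes "e \<in> M" "is_projection e" "p \<in> M" "is_projection p" "h \<in> M" "h * e = h" "h * p = h"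
    "\<And>z. z \<in> M \<Longrightarrow> invol z = z \<Longrightarrow> z * h = 0 \<Longrightarrow> z * e = 0"
  shows "e * p = e"
proof -
  have c: "e * p = p * e" "e * h = h" "p * h = h" using assms comm by auto
  have "(e - e * p) * h = 0" using c by (simp add: algebra_simps)
  then have "(e - e * p) * e = 0" using assms(1-4) c
    by (intro assms(8) mem) (auto simp: is_projection_def)
  moreover have "(e - e * p) * e = e - e * p"
    using c(1) assms(2) by (simp add: algebra_simps is_projection_def flip: c(1)) (metis mult.assoc)
  ultimately show ?thesis by simp
qed

end

subsection \<open>Annihilating projections from monotone completeness\<close>

definition projections_over :: "'a::cstar_algebra \<Rightarrow> 'a set" where
  "projections_over a = {p. is_projection p \<and> a * p = a}"

lemma projections_overD:
  assumes "p \<in> projections_over a"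
  shows "is_projection p" "a * p = a" "invol p = p" "p * p = p"
  using assms by (auto simp: projections_over_def is_projection_def)

lemma projections_over_left:
  assumes "p \<in> projections_over a" "invol a = a" shows "p * a = a"
  using arg_cong[OF projections_overD(2)[OF assms(1)], of invol] projections_overD(3)[OF assms(1)] assms(2)
  by simp

context
  assumes msc: "\<forall>M :: 'a::cstar_algebra set. masa M \<longrightarrow> monotone_sigma_complete M"
begin

text \<open>\<open>g\<close> acts as the spectral projection of \<open>p * q * p\<close> at the
  eigenvalue \<open>1\<close>: the support of \<open>k = p - p * q * p\<close> is removed from
  \<open>p\<close>. From \<open>g * k = 0\<close> follows \<open>g * q * g = g\<close>, which puts
  \<open>g\<close> below \<open>q\<close>, and \<open>a * k = 0\<close> keeps \<open>g\<close> over
  \<open>a\<close>.\<close>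

lemma projections_over_directed:
  fixes a :: 'a
  assumes a: "invol a = a" and p: "p \<in> projections_over a" and q: "q \<in> projections_over a"
  obtains g where "g \<in> projections_over a" "g * p = g" "g * q = g"
proof -
  note pD = projections_overD[OF p] projections_over_left[OF p a]
  note qD = projections_overD[OF q] projections_over_left[OF q a]
  define c where "c = p * q * p"
  have c: "invol c = c" "a * c = a" "c * a = a" "p * c = c" "c * p = c"
    using pD qD by (simp_all add: c_def mult.assoc) (simp_all add: pD qD flip: mult.assoc)
  obtain M where M: "masa M" "{a, p, c} \<subseteq> M"
    by (rule masa_extending[of "{a, p, c}"]) (use a c pD in \<open>auto simp: abelian_def\<close>)
  interpret masa_algebra M by unfold_locales (rule M(1))
  have pM: "p \<in> M" and aM: "a \<in> M" and cM: "c \<in> M" using M by auto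
  define k where "k = p - c"
  have k: "k \<in> M" "invol k = k" "p * k = k" "a * k = 0"
    using pM cM pD c by (auto simp: k_def algebra_simps intro: mem)
  obtain r where r: "r \<in> M" "is_projection r" "k * r = k"
    and ann: "\<And>z. z \<in> M \<Longrightarrow> invol z = z \<Longrightarrow> z * k = 0 \<Longrightarrow> z * r = 0"
    using support_projection[OF _ k(1,2)] msc M(1) by blast
  have rr: "r * r = r" "invol r = r" using r(2) by (auto simp: is_projection_def)
  have ar: "a * r = 0" using ann aM a k(4) by blast
  have prc: "p * r = r * p" using comm pM r(1) .
  have "(r - r * p) * r = 0"
  proof (rule ann)
    show "r - r * p \<in> M" using r(1) pM by (intro mem)
    show "invol (r - r * p) = r - r * p" using rr pD prc by simp
    show "(r - r * p) * k = 0" by (simp add: left_diff_distrib k(3) mult.assoc)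
  qed
  then have "r = r * p * r" by (simp add: left_diff_distrib rr)
  also have "\<dots> = p * r" by (simp only: prc[symmetric] mult.assoc rr)
  finally have rp: "p * r = r" "r * p = r" using prc by simp_all
  define g where "g = p - r"
  have g: "invol g = g" "g * g = g" "a * g = a" "g * p = g" "p * g = g"
    using rr rp pD ar by (simp_all add: g_def algebra_simps)
  have "g * k = 0" using k(3) r(3) comm[OF r(1) k(1)] by (simp add: g_def left_diff_distrib)
  then have "g * p = g * c" by (simp add: k_def right_diff_distrib)
  then have "g * (p * (q * p)) = g" using g(4) by (simp add: c_def mult.assoc)
  then have gqp: "g * (q * p) = g" using g(4) by (metis mult.assoc)
  have gqg: "g * (q * g) = g"
    using arg_cong[OF gqp, of "\<lambda>x. x * g"] g by (simp add: mult.assoc)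
  have "(g - g * q) * invol (g - g * q) = 0"
  proof -
    have "g * (q * (q * g)) = g" using gqg qD(4) by (metis mult.assoc)
    then show ?thesis using g qD gqg by (simp add: algebra_simps)
  qed
  then have "g - g * q = 0" using mult_invol_self_eq_0 by blast
  moreover have "g \<in> projections_over a" using g by (simp add: projections_over_def is_projection_def)
  ultimately show ?thesis using that g by simp
qed

text \<open>A projection over \<open>a\<close> that is least in a masa containing a maximal commuting family of
  projections over \<open>a\<close> is minimal in the whole algebra, hence least since the family of all
  projections over \<open>a\<close> is downward directed.\<close>

lemma least_projection_over:
  fixes a :: 'a
  assumes a: "invol a = a"
  obtains e where "e \<in> projections_over a" "\<And>q. q \<in> projections_over a \<Longrightarrow> e * q = e"
proof -
  obtain S where S: "S \<subseteq> projections_over a" "abelian S"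
    and max: "\<forall>y\<in>projections_over a. (\<forall>t\<in>S. t * y = y * t) \<longrightarrow> y \<in> S"
    using maximal_commuting[of "{}" "projections_over a"] by (auto simp: abelian_def)
  have "abelian (insert a S)"
  proof (rule abelian_insert[OF S(2)])
    fix t assume "t \<in> S"
    then have "t \<in> projections_over a" using S by blast
    then show "t * a = a * t" using projections_overD(2) projections_over_left a by metis
  qed
  moreover have "invol x = x" if "x \<in> insert a S" for x
    using that a S projections_overD(3) by blast
  ultimately obtain M where M: "masa M" "insert a S \<subseteq> M" using masa_extending by metis
  interpret masa_algebra M by unfold_locales (rule M(1))
  obtain e where e: "e \<in> M" "is_projection e" "a * e = a"
    and ann: "\<And>z. z \<in> M \<Longrightarrow> invol z = z \<Longrightarrow> z * a = 0 \<Longrightarrow> z * e = 0"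
    using support_projection[OF _ _ a] msc M by blast
  have least: "e * p = e" if "p \<in> S" for p
  proof (rule support_projection_least[where h = a])
    show "p \<in> M" "is_projection p" "a * p = a" using that M S projections_overD by blast+
  qed (use e M ann in auto)
  have eX: "e \<in> projections_over a" using e by (simp add: projections_over_def)
  have "e * q = e" if q: "q \<in> projections_over a" for q
  proof -
    obtain g where g: "g \<in> projections_over a" "g * e = g" "g * q = g"
      using projections_over_directed[OF a eX q] by blast
    \<comment> \<open>\<open>g\<close> lies below \<open>e\<close>, which lies below every
      \<open>t\<close> in \<open>S\<close>; so \<open>g\<close> commutes with \<open>S\<close>, and
      maximality puts it into \<open>S\<close>. Then \<open>e\<close> is also below
      \<open>g\<close>.\<close>
    have "t * g = g * t" if "t \<in> S" for t
    proof -
      have gt: "g * t = g" using least[OF that] g(2) by (metis mult.assoc)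
      have "invol t = t" using S that projections_overD(3) by blast
      then have "t * g = g" using arg_cong[OF gt, of invol] projections_overD(3)[OF g(1)] by simp
      with gt show ?thesis by simp
    qed
    then have gS: "g \<in> S" using max g(1) by blast
    then have "e * g = e" by (rule least)
    moreover have "e * g = g * e" using comm[OF e(1)] gS M by blast
    ultimately have "g = e" using g(2) by simp
    with g(3) show ?thesis by simp
  qed
  with eX that show ?thesis by blast
qed

lemma ARP_exists:
  fixes x :: 'a
  shows "\<exists>e. is_ARP x e"
proof -
  define a where "a = invol x * x"
  have a: "invol a = a" by (simp add: a_def)
  obtain e where e: "e \<in> projections_over a" and least: "\<And>q. q \<in> projections_over a \<Longrightarrow> e * q = e"
    using least_projection_over[OF a] by blast
  note eD = projections_overD[OF e] projections_over_left[OF e a]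
  have "invol (x - x * e) * (x - x * e) = a - a * e - e * a + e * a * e"
    using eD(3) by (simp add: a_def algebra_simps)
  also have "\<dots> = 0" by (simp add: eD)
  finally have "x - x * e = 0" using invol_mult_self_eq_0 by blast
  moreover have "e * y = 0" if "x * y = 0" for y
  proof -
    define b where "b = y * invol y"
    have ab: "a * b = 0" unfolding a_def b_def using that by (metis mult.assoc mult_zero_left mult_zero_right)
    have b: "invol b = b" by (simp add: b_def)
    have ba: "b * a = 0" using arg_cong[OF ab, of invol] a b by simp
    obtain M where M: "masa M" "{a, b} \<subseteq> M"
      by (rule masa_extending[of "{a, b}"]) (use a b ab ba in \<open>auto simp: abelian_def\<close>)
    interpret masa_algebra M by unfold_locales (rule M(1))
    obtain e' where e': "e' \<in> M" "is_projection e'" "a * e' = a"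
      and ann: "\<And>z. z \<in> M \<Longrightarrow> invol z = z \<Longrightarrow> z * a = 0 \<Longrightarrow> z * e' = 0"
      using support_projection[OF _ _ a] msc M by blast
    have "b * e' = 0" using ann b ba M by blast
    then have "e' * b = 0" using comm[of e' b] e'(1) M by simp
    \<comment> \<open>\<open>e'\<close> depends on \<open>y\<close> through the masa, but
      \<open>e\<close> lies below every projection over \<open>a\<close>, so orthogonality to
      \<open>b\<close> passes down to \<open>e\<close>.\<close>
    moreover have "e * e' = e" using least e' by (simp add: projections_over_def)
    ultimately have "e * b = 0" by (metis mult.assoc mult_zero_right)
    then have "(e * y) * invol (e * y) = 0" by (simp add: b_def eD(3) mult.assoc) (metis mult.assoc mult_zero_left)
    then show ?thesis using mult_invol_self_eq_0 by blast
  qed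
  ultimately show ?thesis unfolding is_ARP_def using eD(1) by auto
qed

end

subsection \<open>Monotone completeness from annihilating projections\<close>

lemma spos_sum: "(\<And>i. i \<in> I \<Longrightarrow> spos (f i)) \<Longrightarrow> spos (sum f I)"
  by (induction I rule: infinite_finite_induct) (auto intro: spos_add)

lemma spos_suminf_diff:
  assumes "summable f" "\<And>n. spos (f n)" shows "spos (suminf f - f n)"
proof (rule spos_tendsto)
  have "(\<lambda>N. \<Sum>k<N. f k) \<longlonglongrightarrow> suminf f" using assms(1) by (rule summable_LIMSEQ)
  \<comment> \<open>The offset \<open>Suc n\<close> puts the term \<open>f n\<close> into every
    partial sum, so a sum of positive terms remains after subtracting it.\<close>
  then show "(\<lambda>N. (\<Sum>k<N + Suc n. f k) - f n) \<longlonglongrightarrow> suminf f - f n"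
    by (intro tendsto_intros LIMSEQ_ignore_initial_segment)
  fix N
  have "(\<Sum>k<N + Suc n. f k) - f n = sum f ({..<N + Suc n} - {n})"
    by (subst sum_diff1) auto
  then show "spos ((\<Sum>k<N + Suc n. f k) - f n)" by (simp only:) (intro spos_sum assms)
qed

section \<open>Positive parts and annihilating projections in a masa\<close>

context masa_algebra
begin

lemma norm_mono:
  assumes "a \<in> M" "b \<in> M" "spos a" "spos (b - a)" shows "norm a \<le> norm b"
proof -
  obtain x where x: "x \<in> M" "spos x" "x * x = a" using sqrt_mem assms by blast
  obtain y where y: "y \<in> M" "spos y" "y * y = b - a" using sqrt_mem assms mem by metis
  have "norm x * norm x \<le> norm (x * x + y * y)" using x y by (intro sum_squares_norm comm) auto
  then show ?thesis using norm_square_sa[of x] x y by simp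
qed

text \<open>Cutting the difference by \<open>1 - e\<close> leaves \<open>- (k - k * e)\<close>, so
  both \<open>k - k * e\<close> and its negative are positive.\<close>

lemma le_projection_mult:
  assumes "k \<in> M" "e \<in> M" "is_projection e" "spos k" "spos (d *\<^sub>R e - k)" shows "k * e = k"
proof -
  have ee: "e * e = e" using assms by (simp add: is_projection_def)
  have "spos ((d *\<^sub>R e - k) - (d *\<^sub>R e - k) * e)"
    using assms projection_spos projection_norm
    by (intro spos_diff_contraction comm mem) auto
  then have "spos (- (k - k * e))" by (simp add: algebra_simps ee)
  moreover have "spos (k - k * e)"
    using assms projection_spos projection_norm by (intro spos_diff_contraction comm) auto
  ultimately show ?thesis using spos_antisym by fastforce
qed

text \<open>By \<open>pos_part_least\<close> this is the supremum of \<open>h\<close> and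
  \<open>0\<close> in \<open>M\<close>. A choice function lets positive parts be taken termwise
  along sequences.\<close>

definition pos_part :: "'a \<Rightarrow> 'a" where
  "pos_part h = (SOME p. p \<in> M \<and> spos p \<and> spos (p - h) \<and> p * (p - h) = 0)"

context
  fixes h assumes h: "h \<in> M" "invol h = h"
begin

lemma pos_part: "pos_part h \<in> M" "spos (pos_part h)" "spos (pos_part h - h)"
  "pos_part h * (pos_part h - h) = 0"
proof -
  obtain p q where "p \<in> M" "q \<in> M" "spos p" "spos q" "h = p - q" "p * q = 0" "q * p = 0"
    by (rule decomposition_mem[OF h])
  then have "\<exists>p. p \<in> M \<and> spos p \<and> spos (p - h) \<and> p * (p - h) = 0" by (intro exI[of _ p]) simp
  from someI_ex[OF this] show "pos_part h \<in> M" "spos (pos_part h)" "spos (pos_part h - h)"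
    "pos_part h * (pos_part h - h) = 0" by (simp_all only: pos_part_def)
qed

text \<open>Let \<open>w\<close> be the negative part of \<open>k - p\<close>. Multiplying
  \<open>k - h\<close> by \<open>w\<close> and \<open>p\<close> leaves \<open>- (w * w * p)\<close>,
  so \<open>w\<close> is orthogonal to \<open>p\<close>; then \<open>w * k = - (w * w)\<close> is
  positive, and \<open>w = 0\<close>.\<close>

lemma pos_part_least:
  assumes k: "k \<in> M" "spos k" "spos (k - h)" shows "spos (k - pos_part h)"
proof -
  define p where "p = pos_part h"
  define q where "q = p - h"
  have pq: "p \<in> M" "q \<in> M" "spos p" "p * q = 0" using pos_part h mem by (auto simp: p_def q_def)
  obtain u w where uw: "u \<in> M" "w \<in> M" "spos u" "spos w" "k - p = u - w" "u * w = 0" "w * u = 0"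
    by (rule decomposition_mem[of "k - p"]) (use k pq in \<open>auto intro: mem\<close>)
  have "k - h = u - w + q" unfolding uw(5)[symmetric] by (simp add: q_def)
  then have "w * (k - h) = w * q - w * w" by (simp only:) (simp add: distrib_left right_diff_distrib uw(7))
  then have "w * (k - h) * p = - (w * w * p)"
    by (simp only:) (simp add: left_diff_distrib mult.assoc comm[OF pq(2,1)] pq(4))
  moreover have "spos (w * (k - h) * p)"
    by (intro spos_mult_mem mem uw(2) k(1) h(1) pq(1) uw(4) k(3) pq(3))
  ultimately have "spos (- (w * w * p))" by (simp only:)
  moreover have "spos (w * w * p)" by (intro spos_mult_mem mem uw(2,4) pq(1,3))
  ultimately have "w * w * p = 0" using spos_antisym by blast
  then have "p * (w * w) = 0" using comm[of p "w * w"] pq uw mem by simp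
  then have "p * w = 0" by (rule mult_eq_0_mem[OF pq(1) uw(2) sposD[OF pq(3)] sposD[OF uw(4)]])
  then have "w * p = 0" using comm[OF uw(2) pq(1)] by simp
  then have "w * k = - (w * w)" using arg_cong[OF uw(5), of "\<lambda>x. w * x"] uw(7)
    by (simp add: right_diff_distrib)
  moreover have "spos (w * k)" by (intro spos_mult_mem uw(2,4) k(1,2))
  ultimately have "spos (- (w * w))" by (simp only:)
  then have "w * w = 0" using spos_antisym[OF spos_square[OF sposD[OF uw(4)]]] by blast
  then have "w = 0" using square_sa_eq_0[of w] uw by simp
  then show ?thesis using uw by (simp add: p_def)
qed

end

lemma monotone_sigma_completeI:
  assumes "\<And>f B. (\<And>n. f n \<in> M) \<Longrightarrow> (\<And>n. invol (f n) = f n) \<Longrightarrow> (\<And>n. spos (f (Suc n) - f n)) \<Longrightarrow>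
      (\<And>n. norm (f n) \<le> B) \<Longrightarrow>
      \<exists>s\<in>M. invol s = s \<and> (\<forall>n. spos (s - f n)) \<and>
        (\<forall>t\<in>M. invol t = t \<longrightarrow> (\<forall>n. spos (t - f n)) \<longrightarrow> spos (t - s))"
  shows "monotone_sigma_complete M"
  unfolding monotone_sigma_complete_def sa_le_def positive_iff_spos self_adjoint_part_def
proof (intro allI impI, elim conjE exE)
  fix f B assume f: "\<forall>n. f n \<in> {x \<in> M. invol x = x}" "\<forall>n. spos (f (Suc n) - f n)" "\<forall>n. norm (f n) \<le> B"
  have "\<exists>s\<in>M. invol s = s \<and> (\<forall>n. spos (s - f n)) \<and>
        (\<forall>t\<in>M. invol t = t \<longrightarrow> (\<forall>n. spos (t - f n)) \<longrightarrow> spos (t - s))"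
    by (rule assms) (use f in auto)
  then show "\<exists>s\<in>{x \<in> M. invol x = x}. (\<forall>n. spos (s - f n)) \<and>
      (\<forall>t\<in>{x \<in> M. invol x = x}. (\<forall>n. spos (t - f n)) \<longrightarrow> spos (t - s))" by auto
qed

text \<open>For \<open>y\<close> in \<open>M\<close>, \<open>x\<close> annihilates
  \<open>y - y * e\<close>, hence so does \<open>e\<close>, which gives
  \<open>e * y = e * y * e\<close>. The same for \<open>invol y\<close> shows that \<open>e\<close>
  commutes with \<open>M\<close>.\<close>

lemma ARP_mem:
  assumes "x \<in> M" "is_ARP x e" shows "e \<in> M"
proof (rule masa_memI[OF masa])
  have e: "invol e = e" "x * e = x" "\<And>y. x * y = 0 \<Longrightarrow> e * y = 0"
    using assms(2) by (auto simp: is_ARP_def is_projection_def)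
  have *: "e * y = e * y * e" if y: "y \<in> M" for y
  proof -
    have "x * (y * e) = x * y"
      using comm[OF assms(1) y] e(2) by (metis mult.assoc)
    then have "x * (y - y * e) = 0" by (simp add: right_diff_distrib)
    then have "e * (y - y * e) = 0" by (rule e(3))
    then have "e * y - e * y * e = 0" by (simp only: right_diff_distrib mult.assoc)
    then show ?thesis by (simp only: right_minus_eq)
  qed
  fix y assume y: "y \<in> M"
  have "y * e = e * y * e" using arg_cong[OF *[of "invol y"], of invol] y mem e(1) by (simp add: mult.assoc)
  also have "\<dots> = e * y" by (rule *[OF y, symmetric])
  finally show "y * e = e * y" .
qed

section \<open>Suprema of positive sequences by binary digits\<close>

context
  assumes wr: "weakly_rickart TYPE('a)"
begin

text \<open>\<open>p\<close> is the annihilating right projection of the weighted sum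
  \<open>x\<close>. Each \<open>f n\<close> lies below \<open>x\<close>, and cutting by
  \<open>1 - p\<close> kills \<open>x\<close>, hence also \<open>f n\<close>.\<close>

lemma join_projection:
  fixes h :: "nat \<Rightarrow> 'a"
  assumes h: "\<And>n. h n \<in> M" "\<And>n. spos (h n)" "\<And>n. norm (h n) \<le> K"
  obtains p where "p \<in> M" "is_projection p" "\<And>n. h n * p = h n"
    "\<forall>z\<in>M. (\<forall>n. z * h n = 0) \<longrightarrow> z * p = 0"
proof -
  define f where "f n = (1/2)^n *\<^sub>R h n" for n
  have f: "f n \<in> M" "spos (f n)" for n using h by (auto simp: f_def intro: mem spos_scale)
  have sf: "summable f"
  proof (rule summable_comparison_test')
    show "summable (\<lambda>n. K * (1/2)^n)" by (intro summable_mult summable_geometric) simp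
    show "norm (f n) \<le> K * (1/2)^n" if "n \<ge> 0" for n
      using h(3)[of n] by (simp add: f_def mult.commute mult_right_mono)
  qed
  define x where "x = suminf f"
  have "(\<Sum>k<N. f k) \<in> M" for N by (induction N) (auto intro: mem f)
  then have x: "x \<in> M" unfolding x_def by (rule lim_mem) (rule summable_LIMSEQ[OF sf])
  obtain p where p: "is_ARP x p" using wr by (auto simp: weakly_rickart_def)
  then have pP: "is_projection p" and xp: "x * p = x" and ann: "\<And>y. x * y = 0 \<Longrightarrow> p * y = 0"
    by (auto simp: is_ARP_def)
  have pM: "p \<in> M" by (rule ARP_mem[OF x p])
  show ?thesis
  proof (rule that[OF pM pP])
    fix n
    have y: "spos (x - f n)" unfolding x_def by (rule spos_suminf_diff[OF sf f(2)])
    have "spos ((x - f n) - (x - f n) * p)"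
      using y pP pM x f projection_spos projection_norm
      by (intro spos_diff_contraction comm mem) auto
    moreover have s: "spos (f n - f n * p)"
      using pP pM f projection_spos projection_norm by (intro spos_diff_contraction comm) auto
    ultimately have "f n - f n * p = 0"
      using spos_add_eq_0[OF s, of "(x - f n) - (x - f n) * p"] xp by (simp add: algebra_simps)
    then show "h n * p = h n" by (simp add: f_def flip: scaleR_right_diff_distrib)
  next
    show "\<forall>z\<in>M. (\<forall>n. z * h n = 0) \<longrightarrow> z * p = 0"
    proof (intro ballI impI)
      fix z assume z: "z \<in> M" "\<forall>n. z * h n = 0"
      have "f n * z = 0" for n using comm[OF h(1)[of n] z(1)] z(2) by (simp add: f_def)
      then have "x * z = 0" unfolding x_def using suminf_mult2[OF sf, of z] by simp
      then have "p * z = 0" by (rule ann)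
      then show "z * p = 0" using comm[OF pM z(1)] by simp
    qed
  qed
qed

text \<open>One bisection step: \<open>p\<close> is the projection onto the region where the supremum exceeds \<open>d\<close>;
  removing \<open>d p\<close> halves the bound and shifts the set of upper bounds by \<open>d p\<close>.\<close>

lemma bisection_step:
  fixes g :: "nat \<Rightarrow> 'a"
  assumes d: "d > 0" and e: "e \<in> M" "is_projection e"
    and g: "\<And>n. g n \<in> M" "\<And>n. spos (g n)" "\<And>n. spos (g (Suc n) - g n)"
      "\<And>n. spos ((2 * d) *\<^sub>R e - g n)"
  obtains p g' where "p \<in> M" "is_projection p"
    "\<And>n. g' n \<in> M" "\<And>n. spos (g' n)" "\<And>n. spos (g' (Suc n) - g' n)" "\<And>n. spos (d *\<^sub>R e - g' n)"
    "\<And>n. spos (d *\<^sub>R p + g' n - g n)"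
    "\<forall>t\<in>M. invol t = t \<longrightarrow> (\<forall>n. spos (t - g n)) \<longrightarrow> (\<forall>n. spos (t - d *\<^sub>R p - g' n))"
proof -
  have ee: "e * e = e" "invol e = e" "spos e" "norm e \<le> 1"
    using e projection_spos projection_norm by (auto simp: is_projection_def)
  have de: "spos (d *\<^sub>R e)" using d ee by (intro spos_scale) auto
  \<comment> \<open>\<open>k n\<close> is the excess of \<open>g n\<close> over the level
    \<open>d\<close>; the projection \<open>p\<close> will be the join of the supports of these
    excesses.\<close>
  define k where "k n = pos_part (g n - d *\<^sub>R e)" for n
  have gde: "g n - d *\<^sub>R e \<in> M" "invol (g n - d *\<^sub>R e) = g n - d *\<^sub>R e" for n
    using g e ee by (auto intro: mem)
  have k: "k n \<in> M" "spos (k n)" "spos (k n - (g n - d *\<^sub>R e))" "k n * (k n - (g n - d *\<^sub>R e)) = 0" for n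
    unfolding k_def using pos_part[OF gde] by auto
  have kd: "spos (d *\<^sub>R e - k n)" for n
    unfolding k_def
  proof (rule pos_part_least[OF gde])
    have "(2 * d) *\<^sub>R e = d *\<^sub>R e + d *\<^sub>R e" by (simp only: mult_2 scaleR_left_distrib)
    then have "d *\<^sub>R e - (g n - d *\<^sub>R e) = (2 * d) *\<^sub>R e - g n" by simp
    then show "spos (d *\<^sub>R e - (g n - d *\<^sub>R e))" by (simp only: g(4))
  qed (use de e in \<open>auto intro: mem\<close>)
  have ke: "k n * e = k n" for n by (rule le_projection_mult[OF k(1) e k(2) kd])
  have kn: "norm (k n) \<le> norm (d *\<^sub>R e)" for n using k kd e by (intro norm_mono mem) auto
  obtain p where p: "p \<in> M" "is_projection p" "\<And>n. k n * p = k n"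
    and ann': "\<forall>z\<in>M. (\<forall>n. z * k n = 0) \<longrightarrow> z * p = 0"
    by (rule join_projection[where h = k, OF k(1,2) kn]) (rule that; simp only:)
  then have ann: "z * p = 0" if "z \<in> M" "\<And>n. z * k n = 0" for z using that by blast
  have pp: "p * p = p" "invol p = p" "spos p" "norm p \<le> 1"
    using p projection_spos projection_norm by (auto simp: is_projection_def)
  have "(p - p * e) * p = 0"
  proof (rule ann)
    fix n
    have "p * k n = k n" "e * k n = k n"
      using p(3)[of n] ke[of n] comm[OF p(1) k(1)[of n]] comm[OF e(1) k(1)[of n]] by simp_all
    then show "(p - p * e) * k n = 0" by (simp add: left_diff_distrib mult.assoc)
  qed (use p e in \<open>auto intro: mem\<close>)
  then have "p * p - p * e * p = 0" by (simp only: left_diff_distrib)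
  then have "p = p * (e * p)" by (simp only: pp(1) mult.assoc right_minus_eq)
  also have "\<dots> = e * p" by (simp only: lcomm[OF p(1) e(1)] pp)
  finally have ep: "e * p = p" by simp
  define g' where "g' n = pos_part (g n - d *\<^sub>R p)" for n
  have gdp: "g n - d *\<^sub>R p \<in> M" "invol (g n - d *\<^sub>R p) = g n - d *\<^sub>R p" for n
    using g p pp by (auto intro: mem)
  have g': "g' n \<in> M" "spos (g' n)" "spos (g' n - (g n - d *\<^sub>R p))" for n
    unfolding g'_def using pos_part[OF gdp] by auto
  have inc: "spos (g' (Suc n) - g' n)" for n
    unfolding g'_def[of n]
  proof (rule pos_part_least[OF gdp g'(1,2)])
    show "spos (g' (Suc n) - (g n - d *\<^sub>R p))"
      using spos_add[OF g'(3)[of "Suc n"] g(3)[of n]] by (simp add: algebra_simps)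
  qed
  have bd: "spos (d *\<^sub>R e - g' n)" for n
    unfolding g'_def
  proof (rule pos_part_least[OF gdp])
    \<comment> \<open>Off \<open>p\<close> the excess vanishes, so \<open>g n\<close> is at most the
      level \<open>d\<close>; on \<open>p\<close> it is at most \<open>2 * d\<close>. The two pieces
      add up to the claim.\<close>
    let ?m = "k n - (g n - d *\<^sub>R e)"
    have "spos (?m - ?m * p)"
      by (intro spos_diff_contraction comm mem k p pp g e)
    moreover have "spos (((2 * d) *\<^sub>R e - g n) * p)" using g e p pp by (intro spos_mult_mem mem) auto
    moreover have "(?m - ?m * p) + ((2 * d) *\<^sub>R e - g n) * p = d *\<^sub>R e - (g n - d *\<^sub>R p)"
      by (simp add: algebra_simps p(3) ep scaleR_2[symmetric])
    ultimately show "spos (d *\<^sub>R e - (g n - d *\<^sub>R p))" using spos_add by metis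
  qed (use de e in \<open>auto intro: mem\<close>)
  \<comment> \<open>The point is that \<open>h\<close>, which is \<open>t\<close> minus
    \<open>d\<close> times \<open>p\<close>, is positive. Each \<open>k n * h\<close> is positive
    because \<open>t\<close> dominates \<open>g n\<close>, so the negative part \<open>w\<close> of
    \<open>h\<close> is orthogonal to \<open>p\<close>; off \<open>p\<close>, \<open>h\<close>
    coincides with the positive \<open>t\<close>.\<close>
  have ub: "spos (t - d *\<^sub>R p - g' n)" if t: "t \<in> M" "invol t = t" "\<And>n. spos (t - g n)" for t n
  proof -
    have ts: "spos t" using spos_add[OF t(3)[of 0] g(2)[of 0]] by simp
    define h where "h = t - d *\<^sub>R p"
    have h: "h \<in> M" "invol h = h" using t p pp by (auto simp: h_def intro: mem)
    obtain u w where uw: "u \<in> M" "w \<in> M" "spos u" "spos w" "h = u - w" "u * w = 0" "w * u = 0"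
      by (rule decomposition_mem[OF h])
    have hw: "h * w = - (w * w)" using uw by (simp add: left_diff_distrib)
    have "w * w * k n = 0" for n
    proof -
      have "k n * (g n - d *\<^sub>R e) = k n * k n" using k(4)[of n] by (simp add: right_diff_distrib)
      then have "k n * h = k n * (t - g n) + k n * k n"
        using p(3)[of n] ke[of n] by (simp add: h_def algebra_simps)
      moreover have "spos (k n * (t - g n) + k n * k n)"
        using k t g by (intro spos_add spos_mult_mem mem)
      ultimately have "spos (k n * h)" by (simp only:)
      then have "spos (k n * h * w)" by (rule spos_mult_mem[OF mem(3)[OF k(1) h(1)] uw(2) _ uw(4)])
      then have "spos (- (k n * (w * w)))" by (simp add: mult.assoc hw)
      moreover have "spos (k n * (w * w))" using k uw by (intro spos_mult_mem mem)
      ultimately have "k n * (w * w) = 0" using spos_antisym by blast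
      then show ?thesis using comm[of "k n" "w * w"] k uw mem by simp
    qed
    then have "w * w * p = 0" using uw by (intro ann mem)
    then have "p * (w * w) = 0" using comm[of "w * w" p] uw p mem by simp
    moreover have "h * p = p * h" using comm h p by blast
    ultimately have "(h - h * p) * w = - (w * w)" by (simp add: left_diff_distrib hw mult.assoc)
    moreover have "h - h * p = t - t * p" by (simp add: h_def algebra_simps pp)
    moreover have "spos (t - t * p)" using ts t p pp comm by (intro spos_diff_contraction) auto
    then have "spos ((t - t * p) * w)" using t p uw by (intro spos_mult_mem mem)
    ultimately have "spos (- (w * w))" by simp
    moreover have "spos (w * w)" using uw by (intro spos_square) simp
    ultimately have "w * w = 0" using spos_antisym by blast
    then have "w = 0" using square_sa_eq_0[of w] uw by simp
    then have "spos h" using uw by simp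
    moreover have "spos (h - (g n - d *\<^sub>R p))" using t(3)[of n] by (simp add: h_def)
    ultimately show ?thesis using pos_part_least[OF gdp h(1)] by (simp add: h_def g'_def)
  qed
  have "spos (d *\<^sub>R p + g' n - g n)" for n using g'(3)[of n] by (simp add: algebra_simps)
  then show ?thesis using that[of p g'] p(1,2) g'(1,2) inc bd ub by blast
qed

end

text \<open>Iterates \<open>bisection_step\<close> with \<open>d = c / 2 ^ Suc k\<close> and
  \<open>e\<close> fixed: \<open>p k\<close> is a binary digit, and \<open>G k\<close> is the
  remainder after the first \<open>k\<close> digits.\<close>

lemma bisection_sequence:
  fixes g :: "nat \<Rightarrow> 'a"
  assumes wr: "weakly_rickart TYPE('a)" and c: "c > 0" and e: "e \<in> M" "is_projection e"
    and g: "\<And>n. g n \<in> M" "\<And>n. spos (g n)" "\<And>n. spos (g (Suc n) - g n)"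
      "\<And>n. spos (c *\<^sub>R e - g n)"
  shows "\<exists>(G :: nat \<Rightarrow> nat \<Rightarrow> 'a) p. G 0 = g \<and>
    (\<forall>k n. G k n \<in> M \<and> spos (G k n) \<and> spos ((c / 2 ^ k) *\<^sub>R e - G k n)) \<and>
    (\<forall>k. p k \<in> M \<and> is_projection (p k) \<and>
      (\<forall>n. spos ((c / 2 ^ Suc k) *\<^sub>R p k + G (Suc k) n - G k n)) \<and>
      (\<forall>t\<in>M. invol t = t \<longrightarrow> (\<forall>n. spos (t - G k n)) \<longrightarrow>
        (\<forall>n. spos (t - (c / 2 ^ Suc k) *\<^sub>R p k - G (Suc k) n))))"
proof -
  define P :: "nat \<Rightarrow> (nat \<Rightarrow> 'a) \<Rightarrow> bool" where "P k f \<longleftrightarrow> (k = 0 \<longrightarrow> f = g) \<and>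
    (\<forall>n. f n \<in> M \<and> spos (f n) \<and> spos (f (Suc n) - f n) \<and> spos ((c / 2 ^ k) *\<^sub>R e - f n))" for k f
  define R :: "nat \<Rightarrow> (nat \<Rightarrow> 'a) \<Rightarrow> (nat \<Rightarrow> 'a) \<Rightarrow> 'a \<Rightarrow> bool" where "R k f f' p \<longleftrightarrow>
    p \<in> M \<and> is_projection p \<and> (\<forall>n. spos ((c / 2 ^ Suc k) *\<^sub>R p + f' n - f n)) \<and>
    (\<forall>t\<in>M. invol t = t \<longrightarrow> (\<forall>n. spos (t - f n)) \<longrightarrow>
      (\<forall>n. spos (t - (c / 2 ^ Suc k) *\<^sub>R p - f' n)))" for k f f' p
  have "\<exists>G. \<forall>k. P k (G k) \<and> (\<exists>p. R k (G k) (G (Suc k)) p)"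
  proof (rule dependent_nat_choice)
    show "\<exists>f. P 0 f" using g by (auto simp: P_def)
  next
    fix f k assume f: "P k f"
    let ?d = "c / 2 ^ Suc k"
    have d: "?d > 0" "2 * ?d = c / 2 ^ k" using c by (simp_all add: field_simps)
    have fP: "\<And>n. f n \<in> M" "\<And>n. spos (f n)" "\<And>n. spos (f (Suc n) - f n)"
      "\<And>n. spos ((2 * ?d) *\<^sub>R e - f n)" using f d(2) by (auto simp: P_def)
    obtain p f' where p: "p \<in> M" "is_projection p"
      and f': "\<And>n. f' n \<in> M" "\<And>n. spos (f' n)" "\<And>n. spos (f' (Suc n) - f' n)"
        "\<And>n. spos (?d *\<^sub>R e - f' n)"
      and pf: "\<And>n. spos (?d *\<^sub>R p + f' n - f n)"
        "\<forall>t\<in>M. invol t = t \<longrightarrow> (\<forall>n. spos (t - f n)) \<longrightarrow> (\<forall>n. spos (t - ?d *\<^sub>R p - f' n))"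
      by (rule bisection_step[where g = f and d = ?d, OF wr d(1) e fP]) (rule that; simp only:)
    have "P (Suc k) f'" using f' by (auto simp: P_def)
    moreover have "R k f f' p" unfolding R_def using p pf by blast
    ultimately show "\<exists>f'. P (Suc k) f' \<and> (\<exists>p. R k f f' p)" by blast
  qed
  then obtain G where G: "\<And>k. P k (G k)" "\<And>k. \<exists>p. R k (G k) (G (Suc k)) p" by blast
  then obtain p where "\<And>k. R k (G k) (G (Suc k)) (p k)" by metis
  with G(1) show ?thesis unfolding P_def R_def by (intro exI[of _ G] exI[of _ p]) simp
qed

lemma positive_sequence_supremum:
  fixes g :: "nat \<Rightarrow> 'a"
  assumes wr: "weakly_rickart TYPE('a)"
    and g: "\<And>n. g n \<in> M" "\<And>n. spos (g n)" "\<And>n. spos (g (Suc n) - g n)" "\<And>n. norm (g n) \<le> K"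
  obtains s where "s \<in> M" "invol s = s" "\<And>n. spos (s - g n)"
    "\<forall>t\<in>M. invol t = t \<longrightarrow> (\<forall>n. spos (t - g n)) \<longrightarrow> spos (t - s)"
proof -
  obtain e where e: "e \<in> M" "is_projection e" "\<And>n. g n * e = g n"
    by (rule join_projection[where h = g, OF wr g(1,2,4)]) blast
  \<comment> \<open>Strictly positive even for \<open>K = 0\<close>, so that each \<open>g n\<close>
    can be scaled to a contraction.\<close>
  define c where "c = max K 0 + 1"
  have c: "c > 0" by (simp add: c_def)
  have ce: "spos (c *\<^sub>R e - g n)" for n
  proof -
    have ee: "e * e = e" "invol e = e" using e(2) by (auto simp: is_projection_def)
    have eg: "e * g n = g n" using comm[OF e(1) g(1)] e(3) by simp
    have "norm ((1/c) *\<^sub>R g n) \<le> 1" using g(4)[of n] c by (simp add: c_def divide_simps)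
    then have "spos (e * e - e * e * ((1/c) *\<^sub>R g n))"
      using c g e(3) eg by (intro spos_mult_contraction_diff spos_scale ee) auto
    then have "spos (e - (1/c) *\<^sub>R g n)" by (simp add: ee eg)
    from spos_scale[OF this, of c] show ?thesis using c by (simp add: scaleR_right_diff_distrib)
  qed
  obtain G p where "G 0 = g"
    and "\<forall>k n. G k n \<in> M \<and> spos (G k n) \<and> spos ((c / 2 ^ k) *\<^sub>R e - G k n)"
    and "\<forall>k. p k \<in> M \<and> is_projection (p k) \<and>
      (\<forall>n. spos ((c / 2 ^ Suc k) *\<^sub>R p k + G (Suc k) n - G k n)) \<and>
      (\<forall>t\<in>M. invol t = t \<longrightarrow> (\<forall>n. spos (t - G k n)) \<longrightarrow>
        (\<forall>n. spos (t - (c / 2 ^ Suc k) *\<^sub>R p k - G (Suc k) n)))"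
    using bisection_sequence[where g = g, OF wr c e(1,2) g(1-3) ce] by (elim exE conjE) blast
  then have G0: "G 0 = g"
    and G: "\<And>k n. G k n \<in> M" "\<And>k n. spos (G k n)" "\<And>k n. spos ((c / 2 ^ k) *\<^sub>R e - G k n)"
    and p: "\<And>k. p k \<in> M" "\<And>k. is_projection (p k)"
    and up: "\<And>k n. spos ((c / 2 ^ Suc k) *\<^sub>R p k + G (Suc k) n - G k n)"
    and least: "\<And>k. \<forall>t\<in>M. invol t = t \<longrightarrow> (\<forall>n. spos (t - G k n)) \<longrightarrow>
      (\<forall>n. spos (t - (c / 2 ^ Suc k) *\<^sub>R p k - G (Suc k) n))"
    by blast+
  define q where "q k = (c / 2 ^ Suc k) *\<^sub>R p k" for k
  have q: "q k \<in> M" "invol (q k) = q k" for k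
    using p by (auto simp: q_def is_projection_def intro: mem)
  have geom: "(\<lambda>k. c * (1/2)^k) \<longlonglongrightarrow> 0"
    by (intro tendsto_mult_right_zero LIMSEQ_realpow_zero) auto
  have pw: "c / 2 ^ k = c * (1/2)^k" for k by (simp add: power_divide)
  have sq: "summable q"
  proof (rule summable_comparison_test')
    show "summable (\<lambda>k. c * (1/2)^k)" by (intro summable_mult summable_geometric) simp
    fix k
    have "norm (q k) \<le> c / 2 ^ Suc k * 1" using projection_norm[OF p(2)[of k]] c
      unfolding q_def norm_scaleR by (intro mult_mono) auto
    also have "\<dots> \<le> c * (1/2)^k" using c by (simp add: power_divide divide_simps)
    finally show "norm (q k) \<le> c * (1/2)^k" .
  qed
  \<comment> \<open>\<open>S k + G k n\<close> dominates \<open>g n\<close> and is dominated by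
    every upper bound of \<open>g\<close>. The remainders tend to \<open>0\<close> in norm, so both
    inequalities pass to the limit of \<open>S\<close>.\<close>
  define S where "S k = (\<Sum>j<k. q j)" for k
  have SM: "S k \<in> M" "invol (S k) = S k" for k
    unfolding S_def by (induction k) (auto intro: mem simp: q)
  have S: "S \<longlonglongrightarrow> suminf q" unfolding S_def[abs_def] by (rule summable_LIMSEQ[OF sq])
  have nG: "norm (G k n) \<le> c * (1/2)^k" for k n
  proof -
    have "norm (G k n) \<le> norm ((c / 2 ^ k) *\<^sub>R e)" using G e by (intro norm_mono mem) auto
    also have "\<dots> \<le> c / 2 ^ k * 1" unfolding norm_scaleR using c projection_norm[OF e(2)]
      by (intro mult_mono) auto
    finally show ?thesis by (simp only: pw mult_1_right)
  qed
  have Glim: "(\<lambda>k. G k n) \<longlonglongrightarrow> 0" for n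
    by (rule tendsto_norm_zero_cancel, rule tendsto_sandwich[OF _ _ tendsto_const geom]) (simp_all add: nG)
  show ?thesis
  proof (rule that[of "suminf q"])
    show "suminf q \<in> M" by (rule lim_mem[OF SM(1) S])
    show "invol (suminf q) = suminf q"
      using tendsto_invol[OF S] S LIMSEQ_unique by (auto simp: SM)
    fix n
    have "spos (S k + G k n - g n)" for k
    proof (induction k)
      case (Suc k)
      from spos_add[OF this up[of k n]] show ?case by (simp add: S_def q_def algebra_simps)
    qed (simp add: S_def G0)
    moreover have "(\<lambda>k. S k + G k n - g n) \<longlonglongrightarrow> suminf q + 0 - g n"
      by (intro tendsto_intros S Glim)
    ultimately show "spos (suminf q - g n)" using spos_tendsto by fastforce
  next
    have "spos (t - suminf q)" if t: "t \<in> M" "invol t = t" "\<And>n. spos (t - g n)" for t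
    proof -
      have "spos (t - S k - G k n)" for k n
      proof (induction k arbitrary: n)
        case (Suc k)
        have "spos (t - S k - (c / 2 ^ Suc k) *\<^sub>R p k - G (Suc k) n)"
          using bspec[OF least[of k], of "t - S k"] t SM Suc by (simp add: mem)
        then show ?case by (simp add: S_def q_def algebra_simps)
      qed (simp add: S_def G0 t)
      moreover have "(\<lambda>k. t - S k - G k 0) \<longlonglongrightarrow> t - suminf q - 0"
        by (intro tendsto_intros S Glim)
      ultimately show ?thesis using spos_tendsto by fastforce
    qed
    then show "\<forall>t\<in>M. invol t = t \<longrightarrow> (\<forall>n. spos (t - g n)) \<longrightarrow> spos (t - suminf q)" by blast
  qed
qed

lemma weakly_rickart_imp_monotone_sigma_complete:
  assumes wr: "weakly_rickart TYPE('a)" shows "monotone_sigma_complete M"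
proof (rule monotone_sigma_completeI)
  fix f B
  assume f: "\<And>n. f n \<in> M" "\<And>n. invol (f n) = f n" "\<And>n. spos (f (Suc n) - f n)" "\<And>n. norm (f n) \<le> B"
  \<comment> \<open>Subtracting the first term makes the sequence positive; its supremum is shifted
    back by \<open>f 0\<close>.\<close>
  define g where "g n = f n - f 0" for n
  have "spos (g n)" for n
  proof (induction n)
    case (Suc n)
    from spos_add[OF this f(3)[of n]] show ?case by (simp add: g_def)
  qed (simp add: g_def)
  note g = this
  have g': "g n \<in> M" "spos (g (Suc n) - g n)" for n using f by (auto simp: g_def intro: mem)
  have "norm (g n) \<le> B + B" for n
    unfolding g_def using norm_triangle_ineq4[of "f n" "f 0"] f(4)[of n] f(4)[of 0] by linarith
  then obtain s where s: "s \<in> M" "invol s = s" "\<And>n. spos (s - g n)"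
    "\<forall>t\<in>M. invol t = t \<longrightarrow> (\<forall>n. spos (t - g n)) \<longrightarrow> spos (t - s)"
    by (rule positive_sequence_supremum[where g = g, OF wr g'(1) g g'(2)]) (rule that; simp only:)
  show "\<exists>s\<in>M. invol s = s \<and> (\<forall>n. spos (s - f n)) \<and>
      (\<forall>t\<in>M. invol t = t \<longrightarrow> (\<forall>n. spos (t - f n)) \<longrightarrow> spos (t - s))"
  proof (intro bexI conjI ballI allI impI)
    show "spos (s + f 0 - f n)" for n using s(3)[of n] by (simp add: g_def algebra_simps)
    fix t assume t: "t \<in> M" "invol t = t" "\<forall>n. spos (t - f n)"
    have "spos (t - f 0 - s)"
      using bspec[OF s(4), of "t - f 0"] t f by (simp add: mem g_def)
    then show "spos (t - (s + f 0))" by (simp add: algebra_simps)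
  qed (use s f in \<open>auto intro: mem\<close>)
qed

end

theorem theorem3p8:
  assumes "\<not> unital TYPE('a::cstar_algebra)"
  shows "weakly_rickart TYPE('a) \<longleftrightarrow>
    (\<forall>M :: 'a set. masa M \<longrightarrow> monotone_sigma_complete M)"
proof
  assume wr: "weakly_rickart TYPE('a)"
  show "\<forall>M :: 'a set. masa M \<longrightarrow> monotone_sigma_complete M"
  proof (intro allI impI)
    fix M :: "'a set" assume "masa M"
    then interpret masa_algebra M by unfold_locales
    show "monotone_sigma_complete M" by (rule weakly_rickart_imp_monotone_sigma_complete[OF wr])
  qed
next
  assume "\<forall>M :: 'a set. masa M \<longrightarrow> monotone_sigma_complete M"
  then show "weakly_rickart TYPE('a)"
    unfolding weakly_rickart_def using ARP_exists by blast
qed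

end
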